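(* For every $n\geq 0$, $\Phi_N$ is a bijection from alternative tableaux of length $n$ (with the standard labeling) to permutations of $\{0,1,\dots,n\}$. Moreover, if $\sigma=\Phi_N(T)$ and $i\in\{1,\dots,n\}$, then $i$ labels: - a row of $T$ if and only if $i$ is an ascent of $\sigma$; - a column of $T$ if and only if $i$ is a descent of $\sigma$; - a free row of $T$ if and only if $i$ is an RL-minimum of $\sigma$; - a free column of $T$ if and only if $i$ is a shifted RL-maximum of $\sigma$.
   Context: Tableaux and labels: - A shape of length $n$ is a Ferrers diagram in English notation, possibly with empty rows or columns, determined by its south-east border: a path of $n$ unit south/west steps from the top-right to the bottom-left corner, where south steps are rows and west steps are columns. - A labeling by $L=\{i_1<\dots<i_n\}$ attaches $i_1,\dots,i_n$ to rows and columns in the order of their steps along this border from top-right to bottom-left; the standard labeling uses $L=\{1,\dots,n\}$. Cell $(i,j)$ (row $i$, column $j$) exists iff $i<j$. The top row has the smallest row label and the leftmost column the largest column label. - An alternative tableau is a shape with a partial filling by left and up arrows such that every cell to the left of a left arrow in its row and every cell above an up arrow in its column is empty. - A free row (column) is one with no left (up) arrow; $Free(T)$ is the set of labels of free rows and columns. $\mathcal{A}_{i,j}$ denotes tableaux with exactly $i$ free rows and $j$ free columns. - For $k\in Free(T)$, $T(k)$ is the smallest $X\subseteq L$ containing $k$ such that for every arrow cell $(i,j)$, $i\in X$ iff $j\in X$. $T[k]$ is the labeled tableau on label set $T(k)$ with rows/columns and fillings inherited from $T$. - $\operatorname{split}(T)=\{T[k]:k\in Free(T)\}$; these are packed tableaux,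 i.e. tableaux of positive length in $\mathcal{A}_{0,1}\cup\mathcal{A}_{1,0}$. - $cut_r$ and $cut_c$ delete the top row, resp. the leftmost column, keeping all other labels. Trees and forests: - A plane alternative tree is a rooted plane tree with distinct integer labels and black/white vertices such that: each white vertex has label smaller than all its descendants, and its children are black with decreasing labels left to right; each black vertex has label larger than all its descendants, and its children are white with increasing labels left to right. - $\operatorname{Tree}$ is defined recursively on labeled packed tableaux $T$. If $T\in\mathcal{A}_{1,0}$, $\operatorname{Tree}(T)$ has a white root labeled by the top row label of $T$, with subtrees $\operatorname{Tree}(U)$ for $U\in\operatorname{split}(cut_r(T))$ ordered by decreasing root labels. If $T\in\mathcal{A}_{0,1}$, $\operatorname{Tree}(T)$ has a black root labeled by the leftmost column label, with subtrees $\operatorname{Tree}(U)$ for $U\in\operatorname{split}(cut_c(T))$ ordered by increasing root labels. - $\operatorname{Forest}(T)=\{\operatorname{Tree}(U):U\in\operatorname{split}(T)\}$. Permutations: - A permutation is a word with distinct integer letters; its support is its set of letters. - $\psi$ of a one-vertex tree labeled $m$ is $m$. Otherwise $\psi(T)=\psi(T_1)\cdots\psi(T_k)\,m$, with $m$ the root label and $T_1,\dots,T_k$ the root subtrees from left to right. - For a forest $F$ with white-rooted trees $T_1,\dots,T_i$ (increasing root labels) and black-rooted trees $T'_1,\dots,T'_j$ (decreasing root labels), $\Psi(F)=\psi(T'_1)\cdots\psi(T'_j)\,0\,\psi(T_1)\cdots\psi(T_i)$. - $\Phi_N:=\Psi\circ\operatorname{Forest}$. - An RL-minimum (RL-maximum)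 is a letter smaller (larger) than all letters to its right. - Writing $w=w_1\,0\,w_2$, a shifted RL-maximum is an RL-maximum of $w_1$. - An ascent is a letter smaller than the next one, or the last letter; a descent is a letter larger than the next one. *)

theory Defs
  imports Main "HOL-Combinatorics.Multiset_Permutations"
begin

section \<open>Labeled shapes and alternative tableaux\<close>

datatype step = South | West

datatype arrow = Left_Arrow | Up_Arrow

text \<open>
  The border lists the steps of the south-east border from the top-right to the bottom-left
  corner, each step together with the label it carries; south steps are rows, west steps columns.
  The entry in row \<open>i\<close> and column \<open>j\<close> is \<open>filling T i j\<close>, where \<open>None\<close> means an empty cell.
\<close>
record tableau =
  border :: "(nat \<times> step) list"
  filling :: "nat \<Rightarrow> nat \<Rightarrow> arrow option"

definition labels :: "tableau \<Rightarrow> nat set" where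
  "labels T = fst ` set (border T)"

definition row_labels :: "tableau \<Rightarrow> nat set" where
  "row_labels T = {i. (i, South) \<in> set (border T)}"

definition col_labels :: "tableau \<Rightarrow> nat set" where
  "col_labels T = {j. (j, West) \<in> set (border T)}"

definition cells :: "tableau \<Rightarrow> (nat \<times> nat) set" where
  "cells T = {(i, j). i \<in> row_labels T \<and> j \<in> col_labels T \<and> i < j}"

text \<open>
  Row labels increase downwards and column labels increase leftwards, so the cells to the left
  of \<open>(i, j)\<close> are the \<open>(i, j')\<close> with \<open>j < j'\<close>, and those above it are the \<open>(i', j)\<close> with
  \<open>i' < i\<close>. Outside the shape the filling is \<open>None\<close>, so that equality of records is equality of
  labeled tableaux.
\<close>
definition alternative_tableau :: "tableau \<Rightarrow> bool" where
  "alternative_tableau T \<longleftrightarrow>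
     sorted_wrt (<) (map fst (border T)) \<and>
     (\<forall>i j. filling T i j \<noteq> None \<longrightarrow> (i, j) \<in> cells T) \<and>
     (\<forall>i j j'. filling T i j = Some Left_Arrow \<and> j < j' \<longrightarrow> filling T i j' = None) \<and>
     (\<forall>i j i'. filling T i j = Some Up_Arrow \<and> i' < i \<longrightarrow> filling T i' j = None)"

definition standard_alternative_tableaux :: "nat \<Rightarrow> tableau set" where
  "standard_alternative_tableaux n =
     {T. alternative_tableau T \<and> map fst (border T) = [1..<Suc n]}"

definition free_rows :: "tableau \<Rightarrow> nat set" where
  "free_rows T = {i \<in> row_labels T. \<forall>j. filling T i j \<noteq> Some Left_Arrow}"

definition free_cols :: "tableau \<Rightarrow> nat set" where
  "free_cols T = {j \<in> col_labels T. \<forall>i. filling T i j \<noteq> Some Up_Arrow}"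

definition Free :: "tableau \<Rightarrow> nat set" where
  "Free T = free_rows T \<union> free_cols T"

definition alternative_tableaux_free :: "nat \<Rightarrow> nat \<Rightarrow> tableau set" where
  "alternative_tableaux_free a b =
     {T. alternative_tableau T \<and> card (free_rows T) = a \<and> card (free_cols T) = b}"

definition restrict_tableau :: "tableau \<Rightarrow> nat set \<Rightarrow> tableau" where
  "restrict_tableau T X =
     \<lparr>border = filter (\<lambda>p. fst p \<in> X) (border T),
      filling = (\<lambda>i j. if i \<in> X \<and> j \<in> X then filling T i j else None)\<rparr>"

text \<open>
  The family below contains \<open>labels T\<close> (for \<open>k \<in> Free T\<close>) and is closed under intersections,
  so its intersection is its least member.
\<close>
definition component_labels :: "tableau \<Rightarrow> nat \<Rightarrow> nat set" where
  "component_labels T k =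
     \<Inter>{X. X \<subseteq> labels T \<and> k \<in> X \<and> (\<forall>i j. filling T i j \<noteq> None \<longrightarrow> (i \<in> X \<longleftrightarrow> j \<in> X))}"

definition component :: "tableau \<Rightarrow> nat \<Rightarrow> tableau" where
  "component T k = restrict_tableau T (component_labels T k)"

definition split_tableau :: "tableau \<Rightarrow> tableau set" where
  "split_tableau T = component T ` Free T"

definition cut_row :: "tableau \<Rightarrow> tableau" where
  "cut_row T = restrict_tableau T (labels T - {Min (row_labels T)})"

definition cut_col :: "tableau \<Rightarrow> tableau" where
  "cut_col T = restrict_tableau T (labels T - {Max (col_labels T)})"

section \<open>Trees and forests\<close>

datatype colour = White | Black

datatype plane_tree = Node (root_colour: colour) (root_label: nat) (subtrees: "plane_tree list")

lemma length_border_restrict_le: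
  "length (border (restrict_tableau T X)) \<le> length (border T)"
  by (simp add: restrict_tableau_def)

lemma length_border_split_le:
  assumes "U \<in> split_tableau T"
  shows "length (border U) \<le> length (border T)"
  using assms by (auto simp: split_tableau_def component_def length_border_restrict_le)

lemma length_border_restrict_less:
  assumes "(m, s) \<in> set (border T)" "m \<notin> X"
  shows "length (border (restrict_tableau T X)) < length (border T)"
  using assms by (auto simp: restrict_tableau_def intro: length_filter_less)

lemma finite_row_labels: "finite (row_labels T)"
  by (rule finite_subset[of _ "fst ` set (border T)"]) (force simp: row_labels_def)+

lemma finite_col_labels: "finite (col_labels T)"
  by (rule finite_subset[of _ "fst ` set (border T)"]) (force simp: col_labels_def)+

lemma length_border_split_cut_row_less:
  assumes "T \<in> alternative_tableaux_free 1 0" "U \<in> split_tableau (cut_row T)"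
  shows "length (border U) < length (border T)"
proof -
  have "free_rows T \<noteq> {}"
    using assms(1) by (auto simp: alternative_tableaux_free_def)
  then have "row_labels T \<noteq> {}" by (auto simp: free_rows_def)
  then have "Min (row_labels T) \<in> row_labels T" by (simp add: finite_row_labels)
  then have "length (border (cut_row T)) < length (border T)"
    unfolding cut_row_def row_labels_def by (auto intro: length_border_restrict_less)
  with length_border_split_le[OF assms(2)] show ?thesis by linarith
qed

lemma length_border_split_cut_col_less:
  assumes "T \<in> alternative_tableaux_free 0 1" "U \<in> split_tableau (cut_col T)"
  shows "length (border U) < length (border T)"
proof -
  have "free_cols T \<noteq> {}"
    using assms(1) by (auto simp: alternative_tableaux_free_def)
  then have "col_labels T \<noteq> {}" by (auto simp: free_cols_def)
  then have "Max (col_labels T) \<in> col_labels T" by (simp add: finite_col_labels)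
  then have "length (border (cut_col T)) < length (border T)"
    unfolding cut_col_def col_labels_def by (auto intro: length_border_restrict_less)
  with length_border_split_le[OF assms(2)] show ?thesis by linarith
qed

text \<open>
  On tableaux that are not packed, \<open>Tree\<close> is unspecified. For packed tableaux, distinct
  subtrees have distinct root labels, so sorting a set of trees by root label is meaningful.
\<close>
function Tree :: "tableau \<Rightarrow> plane_tree" where
  "Tree T =
     (if T \<in> alternative_tableaux_free 1 0 then
        Node White (Min (row_labels T))
          (rev (sorted_key_list_of_set root_label (Tree ` split_tableau (cut_row T))))
      else if T \<in> alternative_tableaux_free 0 1 then
        Node Black (Max (col_labels T))
          (sorted_key_list_of_set root_label (Tree ` split_tableau (cut_col T)))
      else undefined)"
  by pat_completeness auto
termination
  by (relation "measure (\<lambda>T. length (border T))")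
    (auto intro: length_border_split_cut_row_less length_border_split_cut_col_less)

declare Tree.simps [simp del]

definition Forest :: "tableau \<Rightarrow> plane_tree set" where
  "Forest T = Tree ` split_tableau T"

section \<open>Permutations\<close>

fun psi :: "plane_tree \<Rightarrow> nat list" where
  "psi (Node c m ts) = concat (map psi ts) @ [m]"

definition Psi :: "plane_tree set \<Rightarrow> nat list" where
  "Psi F =
     concat (map psi (rev (sorted_key_list_of_set root_label {t \<in> F. root_colour t = Black})))
     @ [0] @
     concat (map psi (sorted_key_list_of_set root_label {t \<in> F. root_colour t = White}))"

definition Phi_N :: "tableau \<Rightarrow> nat list" where
  "Phi_N = Psi \<circ> Forest"

definition is_ascent :: "nat list \<Rightarrow> nat \<Rightarrow> bool" where
  "is_ascent w a \<longleftrightarrow>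
     (\<exists>k < length w. w ! k = a \<and> (Suc k = length w \<or> a < w ! Suc k))"

definition is_descent :: "nat list \<Rightarrow> nat \<Rightarrow> bool" where
  "is_descent w a \<longleftrightarrow> (\<exists>k. Suc k < length w \<and> w ! k = a \<and> w ! Suc k < a)"

definition is_RL_minimum :: "nat list \<Rightarrow> nat \<Rightarrow> bool" where
  "is_RL_minimum w a \<longleftrightarrow>
     (\<exists>k < length w. w ! k = a \<and> (\<forall>l. k < l \<and> l < length w \<longrightarrow> a < w ! l))"

definition is_RL_maximum :: "nat list \<Rightarrow> nat \<Rightarrow> bool" where
  "is_RL_maximum w a \<longleftrightarrow>
     (\<exists>k < length w. w ! k = a \<and> (\<forall>l. k < l \<and> l < length w \<longrightarrow> w ! l < a))"

definition is_shifted_RL_maximum :: "nat list \<Rightarrow> nat \<Rightarrow> bool" where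
  "is_shifted_RL_maximum w a \<longleftrightarrow> (\<exists>w1 w2. w = w1 @ [0] @ w2 \<and> is_RL_maximum w1 a)"

end

theory Submission
  imports Defs
begin

text \<open>
  Let the parent of a non-free row be the column of its left arrow, and the parent of a non-free
  column the row of its up arrow. A tableau is then a forest whose roots are the free labels, the
  trees of \<open>Forest T\<close> are its connected components, and the tableau condition says that rows are
  smaller than their parents and larger than their grandparents, columns the other way round.
  If all free labels are rows, the smallest label \<open>m\<close> is a root, and the word of the forest is
  \<open>w\<^sub>1 m w\<^sub>2\<close>: here \<open>w\<^sub>1\<close> codes the descendants of \<open>m\<close>, a forest with free columns only, and
  \<open>w\<^sub>2\<close> codes the remaining trees. Conversely \<open>m\<close> is found in the word as its smallest letter, so
  bijectivity and the statistics follow by induction, simultaneously with the dual case. Finally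
  \<open>Phi_N T = w\<^sub>1 0 w\<^sub>2\<close> is the word of the forest in which an extra row \<open>0\<close> is made the parent of
  all free columns.
\<close>

section \<open>Colour-symmetric language\<close>

fun flip :: "colour \<Rightarrow> colour" where
  "flip White = Black"
| "flip Black = White"

lemma flip_flip [simp]: "flip (flip c) = c"
  by (cases c) auto

lemma flip_neq [simp]: "flip c \<noteq> c" "c \<noteq> flip c"
  by (cases c; simp)+

lemma neq_iff_flip: "d \<noteq> c \<longleftrightarrow> d = flip c"
  by (cases c; cases d) auto

text \<open>Exchanging rows with columns reverses the order of labels, so \<open>lt c\<close> is the
  order as seen from colour \<open>c\<close>, and one proof covers both colours.\<close>

definition lt :: "colour \<Rightarrow> nat \<Rightarrow> nat \<Rightarrow> bool" where
  "lt c x y \<longleftrightarrow> (case c of White \<Rightarrow> x < y | Black \<Rightarrow> y < x)"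

lemma lt_flip [simp]: "lt (flip c) x y \<longleftrightarrow> lt c y x"
  by (cases c) (auto simp: lt_def)

lemma lt_irrefl [simp]: "\<not> lt c x x"
  by (cases c) (auto simp: lt_def)

lemma lt_asym: "lt c x y \<Longrightarrow> \<not> lt c y x"
  by (cases c) (auto simp: lt_def)

lemma ex_lt_least:
  assumes "finite A" "A \<noteq> {}"
  shows "\<exists>m\<in>A. \<forall>x\<in>A - {m}. lt c m x"
proof (cases c)
  case White
  have "\<forall>x\<in>A - {Min A}. lt c (Min A) x"
    using assms White by (auto simp: lt_def order_less_le)
  then show ?thesis using Min_in[OF assms] by blast
next
  case Black
  have "\<forall>x\<in>A - {Max A}. lt c (Max A) x"
    using assms Black by (auto simp: lt_def order_less_le)
  then show ?thesis using Max_in[OF assms] by blast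
qed

text \<open>This is how \<open>Psi\<close> orders the trees with roots of colour \<open>c\<close>,
  and also how siblings of colour \<open>c\<close> are ordered inside a tree; one function
  \<open>word\<close> can therefore serve for both.\<close>

definition ord :: "colour \<Rightarrow> nat set \<Rightarrow> nat list" where
  "ord c A = (case c of White \<Rightarrow> sorted_list_of_set A | Black \<Rightarrow> rev (sorted_list_of_set A))"

lemma set_ord [simp]: "finite A \<Longrightarrow> set (ord c A) = A"
  by (cases c) (auto simp: ord_def)

lemma ord_empty [simp]: "ord c {} = []"
  by (cases c) (auto simp: ord_def)

lemma ord_Cons:
  assumes "finite A" "m \<in> A" "\<forall>x\<in>A - {m}. lt c m x"
  shows "ord c A = m # ord c (A - {m})"
proof (cases c)
  case White
  have "Min A = m"
    using assms White by (intro Min_eqI) (auto simp: lt_def le_less)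
  then show ?thesis
    using White assms sorted_list_of_set_nonempty[of A] by (auto simp: ord_def)
next
  case Black
  have "sorted (sorted_list_of_set (A - {m}) @ [m])"
    using Black assms by (auto simp: lt_def sorted_append le_less)
  then have "sorted_list_of_set A = sorted_list_of_set (A - {m}) @ [m]"
    using assms by (intro sorted_distinct_set_unique) auto
  then show ?thesis using Black by (simp add: ord_def)
qed

section \<open>Labels, free labels and parents by colour\<close>

definition lab :: "colour \<Rightarrow> tableau \<Rightarrow> nat set" where
  "lab c T = (case c of White \<Rightarrow> row_labels T | Black \<Rightarrow> col_labels T)"

definition free :: "colour \<Rightarrow> tableau \<Rightarrow> nat set" where
  "free c T = (case c of White \<Rightarrow> free_rows T | Black \<Rightarrow> free_cols T)"

text \<open>
  A left arrow in row \<open>i\<close> makes its column the parent of \<open>i\<close>, an up arrow in column \<open>j\<close> makes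
  its row the parent of \<open>j\<close>.
\<close>
definition par :: "tableau \<Rightarrow> (nat \<times> nat) set" where
  "par T = {(i, j). filling T i j = Some Left_Arrow} \<union> {(j, i). filling T i j = Some Up_Arrow}"

lemma labels_eq: "labels T = lab c T \<union> lab (flip c) T"
proof -
  have "labels T = row_labels T \<union> col_labels T"
  proof (intro set_eqI iffI)
    fix x assume "x \<in> labels T"
    then obtain s where "(x, s) \<in> set (border T)" by (auto simp: labels_def)
    then show "x \<in> row_labels T \<union> col_labels T"
      by (cases s) (auto simp: row_labels_def col_labels_def)
  qed (force simp: row_labels_def col_labels_def labels_def)
  then show ?thesis by (cases c) (auto simp: lab_def)
qed

lemma lab_subset_labels: "lab c T \<subseteq> labels T"
  using labels_eq by auto

lemma finite_lab [simp]: "finite (lab c T)"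
  by (cases c) (auto simp: lab_def finite_row_labels finite_col_labels)

lemma finite_labels [simp]: "finite (labels T)"
  by (simp add: labels_def)

lemma Free_eq: "Free T = free c T \<union> free (flip c) T"
  by (cases c) (auto simp: Free_def free_def)

text \<open>
  Alternative tableaux are the two-coloured parent relations in which a label and its grandparent
  are related as required. In this form the conditions are invariant under exchanging rows with
  columns and reversing the order.
\<close>
definition valid :: "(colour \<Rightarrow> nat set) \<Rightarrow> (nat \<times> nat) set \<Rightarrow> bool" where
  "valid l E \<longleftrightarrow>
     (\<forall>c. finite (l c)) \<and> l White \<inter> l Black = {} \<and>
     (\<forall>x p. (x, p) \<in> E \<longrightarrow> (\<exists>c. x \<in> l c \<and> p \<in> l (flip c) \<and> lt c x p)) \<and>
     single_valued E \<and>
     (\<forall>x p q c. (x, p) \<in> E \<and> (p, q) \<in> E \<and> x \<in> l c \<longrightarrow> lt c q x)"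

lemma filling_cell:
  assumes "alternative_tableau T" "filling T i j = Some a"
  shows "i \<in> row_labels T" "j \<in> col_labels T" "i < j"
proof -
  have "(i, j) \<in> cells T"
    using assms unfolding alternative_tableau_def by blast
  then show "i \<in> row_labels T" "j \<in> col_labels T" "i < j"
    by (auto simp: cells_def)
qed

text \<open>The grandparent condition for rows: the left arrow of a row \<open>x\<close> in column
  \<open>p\<close> and the up arrow of \<open>p\<close> in row \<open>q\<close> share a column, and
  nothing lies above an up arrow, so row \<open>q\<close> is above row \<open>x\<close>. Columns are
  dual.\<close>

lemma alternative_tableau_valid:
  assumes T: "alternative_tableau T"
  shows "valid (\<lambda>c. lab c T) (par T)"
proof -
  have d: "distinct (map fst (border T))"
    using T by (auto simp: alternative_tableau_def strict_sorted_iff)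
  have disj: "row_labels T \<inter> col_labels T = {}"
    using eq_key_imp_eq_value[OF d] by (fastforce simp: row_labels_def col_labels_def)
  have cell: "i \<in> row_labels T \<and> j \<in> col_labels T \<and> i < j" if "filling T i j = Some a" for i j a
    using filling_cell[OF T that] by auto
  \<comment> \<open>Column labels increase leftwards and row labels downwards: a left arrow sits in
    the leftmost nonempty cell of its row, an up arrow in the topmost one of its column.\<close>
  have left: "j' \<le> j" if "filling T i j = Some Left_Arrow" "filling T i j' = Some a" for i j j' a
    using T that unfolding alternative_tableau_def by (metis linorder_le_less_linear option.simps(3))
  have up: "i \<le> i'" if "filling T i j = Some Up_Arrow" "filling T i' j = Some a" for i j i' a
    using T that unfolding alternative_tableau_def by (metis linorder_le_less_linear option.simps(3))
  have "\<exists>c. x \<in> lab c T \<and> p \<in> lab (flip c) T \<and> lt c x p" if xp: "(x, p) \<in> par T" for x p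
  proof -
    consider "filling T x p = Some Left_Arrow" | "filling T p x = Some Up_Arrow"
      using xp by (auto simp: par_def)
    then show ?thesis
    proof cases
      case 1
      then show ?thesis using cell by (intro exI[of _ White]) (auto simp: lab_def lt_def)
    next
      case 2
      then show ?thesis using cell by (intro exI[of _ Black]) (auto simp: lab_def lt_def)
    qed
  qed
  moreover have "single_valued (par T)"
    unfolding single_valued_def par_def using disj cell left up
    by (blast intro: le_antisym)
  moreover have "lt c q x" if "(x, p) \<in> par T" "(p, q) \<in> par T" "x \<in> lab c T" for x p q c
  proof (cases c)
    case White
    then have "filling T x p = Some Left_Arrow" "filling T q p = Some Up_Arrow"
      using that cell disj unfolding par_def lab_def by (simp_all, blast+)
    then have "q \<le> x" "q \<noteq> x" using up by auto
    then show ?thesis using White by (simp add: lt_def)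
  next
    case Black
    then have "filling T p x = Some Up_Arrow" "filling T p q = Some Left_Arrow"
      using that cell disj unfolding par_def lab_def by (simp_all, blast+)
    then have "x \<le> q" "q \<noteq> x" using left by auto
    then show ?thesis using Black by (simp add: lt_def)
  qed
  moreover have "lab White T \<inter> lab Black T = {}"
    using disj by (simp add: lab_def)
  ultimately show ?thesis by (auto simp: valid_def)
qed

lemma lab_disjoint: "alternative_tableau T \<Longrightarrow> lab c T \<inter> lab (flip c) T = {}"
  using alternative_tableau_valid[of T] by (cases c) (auto simp: valid_def)

lemma lab_unique: "alternative_tableau T \<Longrightarrow> x \<in> lab c T \<Longrightarrow> x \<in> lab d T \<Longrightarrow> d = c"
  using lab_disjoint[of T c] neq_iff_flip[of d c] by auto

lemma single_valued_par: "alternative_tableau T \<Longrightarrow> single_valued (par T)"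
  using alternative_tableau_valid[of T] by (auto simp: valid_def)

lemma par_lab:
  "alternative_tableau T \<Longrightarrow> (x, p) \<in> par T \<Longrightarrow> \<exists>c. x \<in> lab c T \<and> p \<in> lab (flip c) T \<and> lt c x p"
  using alternative_tableau_valid[of T] by (auto simp: valid_def)

lemma par_child:
  "alternative_tableau T \<Longrightarrow> (x, p) \<in> par T \<Longrightarrow> x \<in> lab c T \<Longrightarrow> p \<in> lab (flip c) T \<and> lt c x p"
  using par_lab lab_unique by blast

lemma par_parent:
  "alternative_tableau T \<Longrightarrow> (x, p) \<in> par T \<Longrightarrow> p \<in> lab c T \<Longrightarrow> x \<in> lab (flip c) T \<and> lt c p x"
  using par_lab[of T x p] lab_unique[of T p] by (metis flip_flip lt_flip)

lemma par_labels: "alternative_tableau T \<Longrightarrow> (x, p) \<in> par T \<Longrightarrow> x \<in> labels T \<and> p \<in> labels T"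
  using par_lab lab_subset_labels by blast

lemma par_grandparent:
  "alternative_tableau T \<Longrightarrow> (x, p) \<in> par T \<Longrightarrow> (p, q) \<in> par T \<Longrightarrow> x \<in> lab c T \<Longrightarrow> lt c q x"
  using alternative_tableau_valid[of T] unfolding valid_def by blast

text \<open>Rows and columns are disjoint, so a label gets a parent only from an arrow of its own
  kind: left for rows, up for columns.\<close>

lemma free_eq:
  assumes T: "alternative_tableau T"
  shows "free c T = lab c T - Domain (par T)"
proof -
  have cell: "i \<in> row_labels T \<and> j \<in> col_labels T" if "filling T i j = Some a" for i j a
    using filling_cell[OF T that] by auto
  have "row_labels T \<inter> col_labels T = {}"
    using lab_disjoint[OF T, of White] by (simp add: lab_def)
  then show ?thesis
    using cell
    by (cases c) (auto simp: free_def lab_def free_rows_def free_cols_def par_def Domain_iff; blast)+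
qed

text \<open>The sorted border is determined by its set of steps, and the colour of the child in a
  pair of \<open>par T\<close> tells which arrow the cell contains.\<close>

lemma alternative_tableau_ext:
  assumes T: "alternative_tableau T" and U: "alternative_tableau U"
    and lab: "\<And>c. lab c T = lab c U" and par: "par T = par U"
  shows "T = U"
proof -
  have "(i, s) \<in> set (border T) \<longleftrightarrow> (i, s) \<in> set (border U)" for i s
    using lab[of "case s of South \<Rightarrow> White | West \<Rightarrow> Black"]
    by (cases s) (auto simp: lab_def row_labels_def col_labels_def)
  then have set: "set (border T) = set (border U)" by auto
  have "sorted (map fst (border T))" "distinct (map fst (border T))"
    "sorted (map fst (border U))" "distinct (map fst (border U))"
    using T U by (auto simp: alternative_tableau_def strict_sorted_iff)
  then have b: "border T = border U"
    using set by (intro map_sorted_distinct_set_unique[where f = fst]) (auto simp: distinct_map)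
  have L: "filling S i j = Some Left_Arrow \<longleftrightarrow> (i, j) \<in> par S \<and> i \<in> lab White S"
    and R: "filling S i j = Some Up_Arrow \<longleftrightarrow> (j, i) \<in> par S \<and> j \<in> lab Black S"
    if "alternative_tableau S" for S i j
    using filling_cell[OF that] lab_disjoint[OF that, of White]
    by (simp_all add: par_def lab_def, blast+)
  have "filling T i j = Some a \<longleftrightarrow> filling U i j = Some a" for i j a
    by (cases a) (simp_all add: L[OF T] R[OF T] L[OF U] R[OF U] lab par)
  then have "filling T i j = filling U i j" for i j
    by (metis not_Some_eq)
  then have "filling T = filling U" by blast
  with b show ?thesis by simp
qed

text \<open>This allows new tableaux to be built from labels and parents alone, without handling
  borders and fillings.\<close>

lemma ex_alternative_tableau:
  assumes v: "valid l E"
  shows "\<exists>T. alternative_tableau T \<and> (\<forall>c. lab c T = l c) \<and> par T = E"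
proof -
  have fin: "finite (l White)" "finite (l Black)" and disj: "l White \<inter> l Black = {}"
    using v by (auto simp: valid_def)
  have E: "(x \<in> l White \<and> p \<in> l Black \<and> x < p) \<or> (x \<in> l Black \<and> p \<in> l White \<and> p < x)"
    if "(x, p) \<in> E" for x p
  proof -
    obtain c where "x \<in> l c \<and> p \<in> l (flip c) \<and> lt c x p"
      using v \<open>(x, p) \<in> E\<close> unfolding valid_def by blast
    then show ?thesis by (cases c) (auto simp: lt_def)
  qed
  have sv: "p = q" if "(x, p) \<in> E" "(x, q) \<in> E" for x p q
    using v that by (auto simp: valid_def single_valued_def)
  have g1: "q < x" if "(x, p) \<in> E" "(p, q) \<in> E" "x \<in> l White" for x p q
    using v that unfolding valid_def lt_def by (metis colour.simps(3))
  have g2: "x < q" if "(x, p) \<in> E" "(p, q) \<in> E" "x \<in> l Black" for x p q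
    using v that unfolding valid_def lt_def by (metis colour.simps(4))
  define T where "T = \<lparr>
    border = map (\<lambda>x. (x, if x \<in> l White then South else West)) (sorted_list_of_set (l White \<union> l Black)),
    filling = (\<lambda>i j. if i \<in> l White \<and> (i, j) \<in> E then Some Left_Arrow
                     else if j \<in> l Black \<and> (j, i) \<in> E then Some Up_Arrow else None)\<rparr>"
  have r: "row_labels T = l White" and c: "col_labels T = l Black"
    using fin disj by (auto simp: T_def row_labels_def col_labels_def image_iff split: if_splits)
  have b: "sorted_wrt (<) (map fst (border T))"
    by (simp add: T_def o_def)
  have f1: "filling T i j = Some Left_Arrow \<longleftrightarrow> i \<in> l White \<and> (i, j) \<in> E" for i j
    by (auto simp: T_def)
  \<comment> \<open>Taking \<open>q = i\<close> in the grandparent condition excludes having both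
    \<open>(i, j)\<close> and \<open>(j, i)\<close> in \<open>E\<close>, so the first branch of the
    filling never hides an up arrow.\<close>
  have f2: "filling T i j = Some Up_Arrow \<longleftrightarrow> j \<in> l Black \<and> (j, i) \<in> E" for i j
    using g1[of i j i] by (auto simp: T_def)
  have f0: "filling T i j = None \<longleftrightarrow> \<not> (i \<in> l White \<and> (i, j) \<in> E) \<and> \<not> (j \<in> l Black \<and> (j, i) \<in> E)" for i j
    by (auto simp: T_def)
  have "alternative_tableau T"
    unfolding alternative_tableau_def
  proof (intro conjI allI impI)
    show "(i, j) \<in> cells T" if "filling T i j \<noteq> None" for i j
      using that E[of i j] E[of j i] disj unfolding cells_def r c f0 by auto
    \<comment> \<open>A second left arrow in row \<open>i\<close> would give \<open>i\<close> two
      parents; an up arrow in column \<open>j'\<close> would make \<open>j\<close> the grandparent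
      of \<open>j'\<close>, so that \<open>j' < j\<close>.\<close>
    show "filling T i j' = None" if "filling T i j = Some Left_Arrow \<and> j < j'" for i j j'
      using that sv[of i j j'] g2[of j' i j] E[of i j] unfolding f0 f1 by auto
    show "filling T i' j = None" if "filling T i j = Some Up_Arrow \<and> i' < i" for i j i'
      using that sv[of j i i'] g1[of i' j i] E[of j i] unfolding f0 f2 by auto
  qed (rule b)
  moreover have "lab c' T = l c'" for c'
    by (cases c') (auto simp: lab_def r c)
  moreover have "par T = E"
    using E by (auto simp: par_def f1 f2)
  ultimately show ?thesis by blast
qed

section \<open>Restriction to a set of labels\<close>

lemma lab_restrict [simp]: "lab c (restrict_tableau T X) = lab c T \<inter> X"
  by (cases c) (auto simp: lab_def restrict_tableau_def row_labels_def col_labels_def)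

lemma labels_restrict [simp]: "labels (restrict_tableau T X) = labels T \<inter> X"
  unfolding labels_eq[of _ White] lab_restrict by blast

lemma par_restrict [simp]: "par (restrict_tableau T X) = par T \<inter> X \<times> X"
  by (auto simp: par_def restrict_tableau_def split: if_splits)

lemma alternative_tableau_restrict:
  assumes "alternative_tableau T"
  shows "alternative_tableau (restrict_tableau T X)"
proof -
  let ?R = "restrict_tableau T X"
  have T: "sorted_wrt (<) (map fst (border T))"
    "\<And>i j. filling T i j \<noteq> None \<Longrightarrow> (i, j) \<in> cells T"
    "\<And>i j j'. filling T i j = Some Left_Arrow \<Longrightarrow> j < j' \<Longrightarrow> filling T i j' = None"
    "\<And>i j i'. filling T i j = Some Up_Arrow \<Longrightarrow> i' < i \<Longrightarrow> filling T i' j = None"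
    using assms unfolding alternative_tableau_def by blast+
  have f: "filling ?R i j = (if i \<in> X \<and> j \<in> X then filling T i j else None)" for i j
    by (simp add: restrict_tableau_def)
  show ?thesis
    unfolding alternative_tableau_def
  proof (intro conjI allI impI)
    show "sorted_wrt (<) (map fst (border ?R))"
      using T(1) by (simp add: restrict_tableau_def sorted_wrt_map sorted_wrt_filter)
    show "(i, j) \<in> cells ?R" if "filling ?R i j \<noteq> None" for i j
      using that T(2)[of i j]
      by (auto simp: f cells_def restrict_tableau_def row_labels_def col_labels_def split: if_splits)
    show "filling ?R i j' = None" if "filling ?R i j = Some Left_Arrow \<and> j < j'" for i j j'
      using that T(3)[of i j j'] by (auto simp: f split: if_splits)
    show "filling ?R i' j = None" if "filling ?R i j = Some Up_Arrow \<and> i' < i" for i j i'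
      using that T(4)[of i j i'] by (auto simp: f split: if_splits)
  qed
qed

lemma restrict_restrict: "Y \<subseteq> X \<Longrightarrow> restrict_tableau (restrict_tableau T X) Y = restrict_tableau T Y"
  by (auto simp: restrict_tableau_def fun_eq_iff intro!: filter_cong)

lemma alternative_tableau_labels_empty:
  assumes "alternative_tableau T" "alternative_tableau U" "labels T = {}" "labels U = {}"
  shows "T = U"
proof (rule alternative_tableau_ext)
  show "lab c T = lab c U" for c
    using assms lab_subset_labels by blast
  show "par T = par U"
    using assms par_labels by fastforce
qed (use assms in auto)

section \<open>Trees as descendants\<close>

definition desc :: "tableau \<Rightarrow> nat \<Rightarrow> nat set" where
  "desc T r = {x. (x, r) \<in> (par T)\<^sup>*}"

text \<open>The condition on \<open>X\<close> in \<open>component_labels\<close>, put in terms of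
  parents: closed sets are the unions of connected components.\<close>

definition closed :: "tableau \<Rightarrow> nat set \<Rightarrow> bool" where
  "closed T X \<longleftrightarrow> (\<forall>(x, p)\<in>par T. x \<in> X \<longleftrightarrow> p \<in> X)"

lemma desc_self [simp]: "r \<in> desc T r"
  by (simp add: desc_def)

lemma desc_subset_closed:
  assumes "closed T X" "r \<in> X"
  shows "desc T r \<subseteq> X"
proof
  fix x assume "x \<in> desc T r"
  then have "(x, r) \<in> (par T)\<^sup>*" by (simp add: desc_def)
  then show "x \<in> X"
    by (induction rule: converse_rtrancl_induct) (use assms in \<open>auto simp: closed_def\<close>)
qed

text \<open>The only parent of a descendant \<open>x\<close> other than \<open>r\<close> is the next
  vertex on its path to \<open>r\<close>, and \<open>r\<close> itself has no parent.\<close>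

lemma closed_desc:
  assumes T: "alternative_tableau T" and r: "r \<notin> Domain (par T)"
  shows "closed T (desc T r)"
  unfolding closed_def
proof clarify
  fix x p assume xp: "(x, p) \<in> par T"
  show "x \<in> desc T r \<longleftrightarrow> p \<in> desc T r"
  proof
    assume "x \<in> desc T r"
    then have "(x, r) \<in> (par T)\<^sup>*" by (simp add: desc_def)
    then show "p \<in> desc T r"
      using xp r single_valued_par[OF T]
      by (cases rule: converse_rtranclE) (auto simp: desc_def single_valued_def)
  next
    assume "p \<in> desc T r"
    then show "x \<in> desc T r"
      using xp by (auto simp: desc_def intro: converse_rtrancl_into_rtrancl)
  qed
qed

lemma closed_labels: "alternative_tableau T \<Longrightarrow> closed T (labels T)"
  using par_labels by (fastforce simp: closed_def)

lemma desc_subset_labels: "alternative_tableau T \<Longrightarrow> r \<in> labels T \<Longrightarrow> desc T r \<subseteq> labels T"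
  by (intro desc_subset_closed closed_labels)

text \<open>\<open>desc T r\<close> is closed and is contained in every closed set containing
  \<open>r\<close>, hence equals the intersection that defines
  \<open>component_labels\<close>.\<close>

lemma component_eq:
  assumes T: "alternative_tableau T" and r: "r \<in> Free T"
  shows "component T r = restrict_tableau T (desc T r)"
proof -
  have r': "r \<notin> Domain (par T)" "r \<in> labels T"
    using r free_eq[OF T] lab_subset_labels[THEN subsetD] unfolding Free_eq[of T White] by auto
  have closed_iff: "(\<forall>i j. filling T i j \<noteq> None \<longrightarrow> (i \<in> X \<longleftrightarrow> j \<in> X)) \<longleftrightarrow> closed T X" for X
  proof -
    have "filling T i j \<noteq> None \<longleftrightarrow> filling T i j = Some Left_Arrow \<or> filling T i j = Some Up_Arrow" for i j
      by (metis arrow.exhaust not_None_eq)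
    then show ?thesis
      unfolding closed_def par_def by blast
  qed
  have "component_labels T r = desc T r"
    unfolding component_labels_def closed_iff
    using closed_desc[OF T r'(1)] desc_subset_labels[OF T r'(2)] desc_subset_closed[of T _ r]
    by (auto intro!: antisym Inter_lower Inter_greatest)
  then show ?thesis by (simp add: component_def)
qed

text \<open>Here \<open>r\<close> need not be free: in \<open>psi_tree\<close> it also ranges over
  the children of a root, and then \<open>tree T r\<close> is a subtree.\<close>

definition tree :: "tableau \<Rightarrow> nat \<Rightarrow> plane_tree" where
  "tree T r = Tree (restrict_tableau T (desc T r))"

lemma desc_restrict:
  assumes "desc T r \<subseteq> X"
  shows "desc (restrict_tableau T X) r = desc T r"
proof
  show "desc (restrict_tableau T X) r \<subseteq> desc T r"
    using rtrancl_mono[of "par (restrict_tableau T X)" "par T"] by (auto simp: desc_def)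
  show "desc T r \<subseteq> desc (restrict_tableau T X) r"
  proof
    fix x assume "x \<in> desc T r"
    then have "(x, r) \<in> (par T)\<^sup>*" by (simp add: desc_def)
    then show "x \<in> desc (restrict_tableau T X) r"
    proof (induction rule: converse_rtrancl_induct)
      case (step x y)
      then have "x \<in> X" "y \<in> X"
        using assms by (auto simp: desc_def intro: converse_rtrancl_into_rtrancl)
      then show ?case
        using step by (auto simp: desc_def intro: converse_rtrancl_into_rtrancl)
    qed simp
  qed
qed

lemma tree_restrict: "desc T r \<subseteq> X \<Longrightarrow> tree (restrict_tableau T X) r = tree T r"
  by (simp add: tree_def desc_restrict restrict_restrict)

lemma Tree_image_split:
  assumes "alternative_tableau T"
  shows "Tree ` split_tableau T = tree T ` Free T"
  unfolding split_tableau_def image_image tree_def using component_eq[OF assms] by simp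

text \<open>If no label of colour \<open>flip c\<close> is free, then the extremal label is a root: it cannot have
  colour \<open>flip c\<close>, for its parent would be more extreme, and it has no parent, for its parent
  would have a parent that is more extreme.\<close>
lemma extreme_is_free:
  assumes T: "alternative_tableau T" and c: "free (flip c) T = {}"
    and m: "m \<in> labels T" "\<forall>x\<in>labels T - {m}. lt c m x"
  shows "m \<in> free c T"
proof -
  have nlt: "\<not> lt c x m" if "x \<in> labels T" for x
    using m that lt_asym by (metis Diff_iff empty_iff insert_iff lt_irrefl)
  have nlab: "m \<notin> lab (flip c) T"
  proof
    assume l: "m \<in> lab (flip c) T"
    then obtain p where "(m, p) \<in> par T"
      using c free_eq[OF T, of "flip c"] by auto
    then show False
      using par_child[OF T _ l] nlt par_labels[OF T] by fastforce
  qed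
  then have l: "m \<in> lab c T" using m labels_eq by auto
  moreover have "m \<notin> Domain (par T)"
  proof
    assume "m \<in> Domain (par T)"
    then obtain p where mp: "(m, p) \<in> par T" by auto
    then have "p \<in> lab (flip c) T" using par_child[OF T _ l] by blast
    then obtain q where "(p, q) \<in> par T"
      using c free_eq[OF T, of "flip c"] by auto
    then show False
      using par_grandparent[OF T mp _ l] nlt par_labels[OF T] by blast
  qed
  ultimately show ?thesis using free_eq[OF T] by auto
qed

section \<open>Deleting a root\<close>

definition del :: "nat \<Rightarrow> tableau \<Rightarrow> tableau" where
  "del m T = restrict_tableau T (labels T - {m})"

lemma lab_del [simp]: "lab c (del m T) = lab c T - {m}"
  unfolding del_def lab_restrict using lab_subset_labels by blast

lemma labels_del [simp]: "labels (del m T) = labels T - {m}"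
  by (auto simp: del_def)

lemma alternative_tableau_del: "alternative_tableau T \<Longrightarrow> alternative_tableau (del m T)"
  by (simp add: del_def alternative_tableau_restrict)

lemma par_del:
  "alternative_tableau T \<Longrightarrow> m \<notin> Domain (par T) \<Longrightarrow> par (del m T) = par T - UNIV \<times> {m}"
  using par_labels[of T] unfolding del_def par_restrict by auto

text \<open>The children of \<open>m\<close> have colour \<open>flip c\<close> and lose their only
  parent, so they become free; no other label is affected.\<close>

lemma free_del:
  assumes T: "alternative_tableau T" and m: "m \<in> free c T"
  shows "free c (del m T) = free c T - {m}"
    and "free (flip c) (del m T) = free (flip c) T \<union> {x. (x, m) \<in> par T}"
proof -
  have m': "m \<in> lab c T" "m \<notin> Domain (par T)"
    using m free_eq[OF T] by auto
  have ch: "x \<in> lab (flip c) T \<and> x \<noteq> m \<and> x \<notin> lab c T" if "(x, m) \<in> par T" for x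
    using that par_parent[OF T that m'(1)] lab_disjoint[OF T, of c] m'(1) by auto
  have sv: "p = m" if "(x, m) \<in> par T" "(x, p) \<in> par T" for x p
    using that single_valued_par[OF T] by (auto simp: single_valued_def)
  show "free c (del m T) = free c T - {m}"
    unfolding free_eq[OF alternative_tableau_del[OF T]] free_eq[OF T] par_del[OF T m'(2)] lab_del
    using ch by auto
  show "free (flip c) (del m T) = free (flip c) T \<union> {x. (x, m) \<in> par T}"
    unfolding free_eq[OF alternative_tableau_del[OF T]] free_eq[OF T] par_del[OF T m'(2)] lab_del
    using ch sv m'(1) lab_disjoint[OF T, of c] by auto
qed

lemma desc_not_mem:
  assumes "m \<notin> Domain (par T)" "r \<noteq> m"
  shows "m \<notin> desc T r"
  using assms by (auto simp: desc_def elim: converse_rtranclE)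

text \<open>A closed set contains the parents of its members, so restricting to it deprives no label
  of its parent.\<close>

lemma free_closed:
  assumes T: "alternative_tableau T" and X: "closed T X"
  shows "free c (restrict_tableau T X) = free c T \<inter> X"
  using X unfolding free_eq[OF T] free_eq[OF alternative_tableau_restrict[OF T]] closed_def by auto

lemma free_subset_labels: "alternative_tableau T \<Longrightarrow> free c T \<subseteq> labels T"
  using free_eq lab_subset_labels by blast

lemma finite_free [simp]: "finite (free c T)"
  using finite_subset[OF _ finite_lab[of c T], of "free c T"]
  by (cases c) (auto simp: free_def lab_def free_rows_def free_cols_def)

text \<open>Every descendant of \<open>r\<close> other than \<open>r\<close> has a parent, so the
  component is a packed tableau.\<close>

lemma free_component:
  assumes T: "alternative_tableau T" and r: "r \<in> free c T"
  shows "free d (restrict_tableau T (desc T r)) = (if d = c then {r} else {})"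
proof -
  have "r \<notin> Domain (par T)" using r free_eq[OF T] by auto
  then have "free d (restrict_tableau T (desc T r)) = free d T \<inter> desc T r"
    by (intro free_closed T closed_desc)
  also have "\<dots> = free d T \<inter> {r}"
    using free_eq[OF T] by (auto simp: desc_def elim: converse_rtranclE)
  also have "\<dots> = (if d = c then {r} else {})"
    using r free_eq[OF T] lab_unique[OF T] by auto
  finally show ?thesis .
qed

text \<open>By \<open>extreme_is_free\<close> the only free label is also the extremal one, so it is
  the label that \<open>cut_row\<close> or \<open>cut_col\<close> removes, and both cuts become
  \<open>del r\<close>.\<close>

lemma Tree_packed:
  assumes T: "alternative_tableau T" and r: "free c T = {r}" "free (flip c) T = {}"
  shows "Tree T = Node c r (case c of
      White \<Rightarrow> rev (sorted_key_list_of_set root_label (tree (del r T) ` Free (del r T)))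
    | Black \<Rightarrow> sorted_key_list_of_set root_label (tree (del r T) ` Free (del r T)))"
proof -
  have rl: "r \<in> lab c T" using r free_eq[OF T] by auto
  then have "labels T \<noteq> {}" using lab_subset_labels by blast
  then obtain m where m: "m \<in> labels T" "\<forall>x\<in>labels T - {m}. lt c m x"
    using ex_lt_least[OF finite_labels, of T c] by auto
  with extreme_is_free[OF T r(2) m] r(1) have m: "\<forall>x\<in>labels T - {r}. lt c r x" by auto
  then have ex: "\<forall>x\<in>lab c T - {r}. lt c r x" using lab_subset_labels by blast
  show ?thesis
  proof (cases c)
    case White
    have "Min (row_labels T) = r"
      using ex rl White by (intro Min_eqI) (auto simp: lab_def lt_def finite_row_labels le_less)
    moreover from this have "cut_row T = del r T" by (simp add: cut_row_def del_def)
    moreover have "T \<in> alternative_tableaux_free 1 0"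
      using T r White by (auto simp: alternative_tableaux_free_def free_def)
    ultimately show ?thesis
      using White Tree_image_split[OF alternative_tableau_del[OF T]]
      by (subst Tree.simps) simp
  next
    case Black
    have "Max (col_labels T) = r"
      using ex rl Black by (intro Max_eqI) (auto simp: lab_def lt_def finite_col_labels le_less)
    moreover from this have "cut_col T = del r T" by (simp add: cut_col_def del_def)
    moreover have "T \<in> alternative_tableaux_free 0 1" "T \<notin> alternative_tableaux_free 1 0"
      using T r Black by (auto simp: alternative_tableaux_free_def free_def)
    ultimately show ?thesis
      using Black Tree_image_split[OF alternative_tableau_del[OF T]]
      by (subst Tree.simps) simp
  qed
qed

lemma tree_root:
  assumes T: "alternative_tableau T" and r: "r \<in> free c T"
  shows "root_label (tree T r) = r" "root_colour (tree T r) = c"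
  using Tree_packed[OF alternative_tableau_restrict[OF T], of c "desc T r" r] free_component[OF T r]
  by (auto simp: tree_def)

lemma inj_on_tree: "alternative_tableau T \<Longrightarrow> inj_on (tree T) (Free T)"
  by (rule inj_on_inverseI[of _ root_label]) (auto simp: Free_eq[of T White] tree_root)

lemma (in linorder) sorted_key_list_of_set_idem:
  assumes "inj_on f (set xs)" "sorted (map f xs)" "distinct xs"
  shows "sorted_key_list_of_set f (set xs) = xs"
proof -
  \<comment> \<open>The locale asks for injectivity on a carrier set only. It is
    \<open>set xs\<close> here, since \<open>root_label\<close> is injective on the trees at hand
    but not on all trees.\<close>
  interpret folding_insort_key "(\<le>)" "(<)" "set xs" f
    by unfold_locales (rule assms(1))
  show ?thesis using assms by (intro idem_if_sorted_distinct) auto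
qed

text \<open>Since \<open>tree T r\<close> has root label \<open>r\<close>, sorting trees by root
  label amounts to sorting the labels themselves.\<close>

lemma sorted_key_list_tree:
  assumes T: "alternative_tableau T" and A: "A \<subseteq> Free T"
  shows "sorted_key_list_of_set root_label (tree T ` A) = map (tree T) (sorted_list_of_set A)"
proof -
  have root: "root_label (tree T r) = r" if "r \<in> A" for r
    using that A tree_root[OF T] by (auto simp: Free_eq[of T White])
  have fin: "finite A"
    using A finite_subset by (fastforce simp: Free_eq[of T White])
  have inj: "inj_on (tree T) A" using inj_on_tree[OF T] A inj_on_subset by blast
  have "map root_label (map (tree T) (sorted_list_of_set A)) = sorted_list_of_set A"
    using fin root by (auto intro: map_idI)
  then show ?thesis
    using sorted_key_list_of_set_idem[of root_label "map (tree T) (sorted_list_of_set A)"] fin inj root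
    by (simp add: distinct_map inj_on_def)
qed

section \<open>Words\<close>

text \<open>The half of \<open>Psi\<close> that belongs to the roots of colour
  \<open>c\<close>.\<close>

definition word :: "colour \<Rightarrow> tableau \<Rightarrow> nat list" where
  "word c T = concat (map (\<lambda>r. psi (tree T r)) (ord c (free c T)))"

text \<open>Deleting \<open>r\<close> from its component frees exactly the children of
  \<open>r\<close> and leaves their descendants unchanged, so the subtrees at the root are the trees
  of the children.\<close>

lemma psi_tree:
  assumes T: "alternative_tableau T" and r: "r \<in> free c T"
  shows "psi (tree T r) = concat (map (\<lambda>x. psi (tree T x)) (ord (flip c) {x. (x, r) \<in> par T})) @ [r]"
proof -
  define K where "K = {x. (x, r) \<in> par T}"
  define C where "C = restrict_tableau T (desc T r)"
  have r': "r \<in> lab c T" "r \<notin> Domain (par T)" "r \<in> labels T"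
    using r free_eq[OF T] lab_subset_labels[of c T] by auto
  have C: "alternative_tableau C" "free c C = {r}" "free (flip c) C = {}"
    unfolding C_def using alternative_tableau_restrict[OF T] free_component[OF T r] by auto
  have D: "alternative_tableau (del r C)" using C(1) by (rule alternative_tableau_del)
  have rC: "r \<in> free c C" using C(2) by simp
  have parC: "{x. (x, r) \<in> par C} = K"
    by (auto simp: C_def K_def desc_def)
  have free: "Free (del r C) = K"
    unfolding Free_eq[of _ c] free_del[OF C(1) rC] C parC by simp
  have "labels C = desc T r"
    using desc_subset_labels[OF T r'(3)] by (auto simp: C_def)
  then have del: "del r C = restrict_tableau T (desc T r - {r})"
    by (simp add: del_def) (simp add: C_def restrict_restrict)
  have sub: "desc T x \<subseteq> desc T r - {r}" if "x \<in> K" for x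
  proof -
    have xr: "(x, r) \<in> par T" using that by (simp add: K_def)
    then have "x \<noteq> r" using r'(2) by auto
    then have "r \<notin> desc T x" using desc_not_mem[OF r'(2)] by blast
    moreover have "desc T x \<subseteq> desc T r"
      using xr by (auto simp: desc_def)
    ultimately show ?thesis by blast
  qed
  have "tree (del r C) x = tree T x" if "x \<in> K" for x
    unfolding del using sub[OF that] by (rule tree_restrict)
  moreover have "finite K" using free finite_free[of _ "del r C"] unfolding Free_eq[of _ White]
    by (metis finite_Un)
  ultimately have "map (tree (del r C)) (sorted_list_of_set K) = map (tree T) (sorted_list_of_set K)"
    by simp
  then have "sorted_key_list_of_set root_label (tree (del r C) ` Free (del r C)) =
      map (tree T) (sorted_list_of_set K)"
    using sorted_key_list_tree[OF D order_refl] free by simp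
  \<comment> \<open>A black root takes its children in increasing order, a white root takes the
    reversed list; both orders are \<open>ord (flip c)\<close>.\<close>
  then have "tree T r = Node c r (map (tree T) (ord (flip c) K))"
    unfolding tree_def[of T r] C_def[symmetric] Tree_packed[OF C]
    by (cases c) (simp_all add: ord_def rev_map)
  then show ?thesis by (simp add: K_def o_def)
qed

lemma word_restrict:
  assumes "\<And>r. r \<in> free c (restrict_tableau T X) \<Longrightarrow> desc T r \<subseteq> X"
  shows "word c (restrict_tableau T X) =
    concat (map (\<lambda>r. psi (tree T r)) (ord c (free c (restrict_tableau T X))))"
  unfolding word_def using assms
  by (intro arg_cong[of _ _ concat] map_cong refl) (simp add: tree_restrict)

text \<open>Trees with roots in a closed set lie inside it, so the rest of \<open>T\<close> does not
  affect their words.\<close>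

lemma word_closed:
  assumes "alternative_tableau T" "closed T X" "free c T \<subseteq> X"
  shows "word c (restrict_tableau T X) = word c T"
proof -
  have "free c (restrict_tableau T X) = free c T"
    using assms free_closed by blast
  then show ?thesis
    using word_restrict[of c T X] desc_subset_closed[OF assms(2)] assms(3) by (auto simp: word_def)
qed

text \<open>The letter \<open>m\<close> is the root of the first tree, whose children are the free labels of
  colour \<open>flip c\<close> that appear when \<open>m\<close> is deleted.\<close>
lemma word_del:
  assumes T: "alternative_tableau T" and c: "free (flip c) T = {}"
    and m: "m \<in> labels T" "\<forall>x\<in>labels T - {m}. lt c m x"
  shows "word c T = word (flip c) (del m T) @ m # word c (del m T)"
proof -
  have mf: "m \<in> free c T" using extreme_is_free[OF T c m] .
  then have m': "m \<notin> Domain (par T)" using free_eq[OF T] by auto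
  have sub: "desc T r \<subseteq> labels T - {m}" if "r \<in> free d (del m T)" for r d
  proof -
    have "r \<in> labels T" "r \<noteq> m"
      using that free_subset_labels[OF alternative_tableau_del[OF T]] by fastforce+
    then show ?thesis
      using desc_subset_labels[OF T] desc_not_mem[OF m'] by blast
  qed
  have w: "word d (del m T) = concat (map (\<lambda>r. psi (tree T r)) (ord d (free d (del m T))))" for d
    using word_restrict[of d T "labels T - {m}"] sub by (simp add: del_def)
  have "ord c (free c T) = m # ord c (free c T - {m})"
    using m(2) mf free_subset_labels[OF T] by (intro ord_Cons) auto
  then have "word c T = psi (tree T m) @ word c (del m T)"
    unfolding w free_del(1)[OF T mf] by (simp add: word_def)
  also have "psi (tree T m) = word (flip c) (del m T) @ [m]"
    unfolding w free_del(2)[OF T mf] psi_tree[OF T mf] c by simp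
  finally show ?thesis by simp
qed

text \<open>Root colours separate the two halves of \<open>Psi\<close>. From here on
  \<open>Phi_N\<close> is handled through \<open>word\<close> alone.\<close>

lemma Phi_N_eq:
  assumes T: "alternative_tableau T"
  shows "Phi_N T = word Black T @ [0] @ word White T"
proof -
  have Free: "Free T = free White T \<union> free Black T" using Free_eq[of T White] by simp
  have F: "Forest T = tree T ` Free T"
    by (simp add: Forest_def Tree_image_split[OF T])
  have "{t \<in> Forest T. root_colour t = c} = tree T ` free c T" for c
    unfolding F using tree_root(2)[OF T]
    by (cases c) (auto simp: Free)
  moreover have "sorted_key_list_of_set root_label (tree T ` free c T) =
      map (tree T) (sorted_list_of_set (free c T))" for c
    by (rule sorted_key_list_tree[OF T]) (cases c; auto simp: Free)
  ultimately show ?thesis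
    by (simp add: Phi_N_def Psi_def word_def ord_def o_def rev_map)
qed

section \<open>Gluing\<close>

text \<open>Passing from a row to its grandparent decreases the label, so climbing from a row ends
  at a root; a column that is not free has a row as its parent.\<close>

lemma ex_root:
  assumes T: "alternative_tableau T" and x: "x \<in> labels T"
  shows "\<exists>r\<in>Free T. x \<in> desc T r"
proof -
  have step: "\<exists>r\<in>Free T. x \<in> desc T r" if "(x, p) \<in> par T" "\<exists>r\<in>Free T. p \<in> desc T r" for x p
    using that by (auto simp: desc_def intro: converse_rtrancl_into_rtrancl)
  have free: "x \<in> Free T \<or> (\<exists>p. (x, p) \<in> par T)" if "x \<in> lab c T" for x c
    using that free_eq[OF T, of c] by (auto simp: Free_eq[of T c])
  have "x \<in> lab White T \<Longrightarrow> \<exists>r\<in>Free T. x \<in> desc T r" for x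
  proof (induction x rule: less_induct)
    case (less x)
    show ?case
    proof (cases "x \<in> Free T")
      case True
      then show ?thesis using desc_self by blast
    next
      case False
      then obtain p where p: "(x, p) \<in> par T" using free[OF less.prems] by blast
      have pl: "p \<in> lab Black T" using par_child[OF T p less.prems] by simp
      have "\<exists>r\<in>Free T. p \<in> desc T r"
      proof (cases "p \<in> Free T")
        case True
        then show ?thesis using desc_self by blast
      next
        case False
        then obtain q where q: "(p, q) \<in> par T" using free[OF pl] by blast
        have "q \<in> lab White T" using par_child[OF T q pl] by simp
        moreover have "q < x"
          using par_grandparent[OF T p q less.prems] by (simp add: lt_def)
        ultimately show ?thesis using less.IH step[OF q] by blast
      qed
      then show ?thesis by (rule step[OF p])
    qed
  qed
  moreover have "\<exists>r\<in>Free T. x \<in> desc T r" if xl: "x \<in> lab Black T"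
  proof (cases "x \<in> Free T")
    case True
    then show ?thesis using desc_self by blast
  next
    case False
    then obtain p where p: "(x, p) \<in> par T" using free[OF xl] by blast
    have "p \<in> lab White T" using par_child[OF T p xl] by simp
    then show ?thesis using calculation step[OF p] by blast
  qed
  ultimately show ?thesis using x labels_eq[of T White] by auto
qed

lemma closed_ancestor:
  assumes "closed T X" "x \<in> X" "x \<in> desc T r"
  shows "r \<in> X"
proof -
  have "(x, r) \<in> (par T)\<^sup>*" using assms by (simp add: desc_def)
  then show ?thesis
    by (induction rule: rtrancl_induct) (use assms in \<open>auto simp: closed_def\<close>)
qed

text \<open>\<open>desc T s\<close> is closed and contains \<open>x\<close>, hence also the ancestor
  \<open>r\<close> of \<open>x\<close>; but \<open>r\<close> has no parent, so
  \<open>r = s\<close>.\<close>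

lemma root_unique:
  assumes T: "alternative_tableau T" and "r \<in> Free T" "s \<in> Free T" "x \<in> desc T r" "x \<in> desc T s"
  shows "r = s"
proof -
  have rs: "r \<notin> Domain (par T)" "s \<notin> Domain (par T)"
    using assms free_eq[OF T] by (auto simp: Free_eq[of T White])
  then have "r \<in> desc T s"
    using closed_ancestor[OF closed_desc[OF T]] assms by blast
  then show ?thesis
    using rs by (auto simp: desc_def elim: converse_rtranclE)
qed

section \<open>Splitting a forest by the colour of its roots\<close>

definition part :: "colour \<Rightarrow> tableau \<Rightarrow> tableau" where
  "part c T = restrict_tableau T (\<Union>r\<in>free c T. desc T r)"

lemma closed_part:
  assumes T: "alternative_tableau T"
  shows "closed T (\<Union>r\<in>free c T. desc T r)" "(\<Union>r\<in>free c T. desc T r) \<subseteq> labels T"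
proof -
  show "closed T (\<Union>r\<in>free c T. desc T r)"
    unfolding closed_def
  proof clarify
    fix x p assume xp: "(x, p) \<in> par T"
    have "x \<in> desc T r \<longleftrightarrow> p \<in> desc T r" if "r \<in> free c T" for r
    proof -
      have "closed T (desc T r)"
        using that free_eq[OF T] by (intro closed_desc T) auto
      then show ?thesis using xp by (auto simp: closed_def)
    qed
    then show "x \<in> (\<Union>r\<in>free c T. desc T r) \<longleftrightarrow> p \<in> (\<Union>r\<in>free c T. desc T r)" by blast
  qed
  show "(\<Union>r\<in>free c T. desc T r) \<subseteq> labels T"
    using desc_subset_labels[OF T] free_subset_labels[OF T] by blast
qed

lemma alternative_tableau_part: "alternative_tableau T \<Longrightarrow> alternative_tableau (part c T)"
  by (simp add: part_def alternative_tableau_restrict)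

lemma labels_part: "alternative_tableau T \<Longrightarrow> labels (part c T) = (\<Union>r\<in>free c T. desc T r)"
  unfolding part_def labels_restrict using closed_part(2) by blast

lemma labels_part_Un:
  assumes T: "alternative_tableau T"
  shows "labels (part c T) \<union> labels (part (flip c) T) = labels T"
proof -
  have "x \<in> labels (part c T) \<union> labels (part (flip c) T)" if "x \<in> labels T" for x
    using ex_root[OF T that] by (auto simp: labels_part[OF T] Free_eq[of T c])
  moreover have "labels (part d T) \<subseteq> labels T" for d
    using closed_part(2)[OF T] by (simp add: labels_part[OF T])
  ultimately show ?thesis by blast
qed

lemma labels_part_disjoint:
  assumes T: "alternative_tableau T"
  shows "labels (part c T) \<inter> labels (part (flip c) T) = {}"
proof -
  have "free c T \<inter> free (flip c) T = {}"
    using free_eq[OF T] lab_disjoint[OF T, of c] by auto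
  then show ?thesis
    using root_unique[OF T] by (fastforce simp: labels_part[OF T] Free_eq[of T c])
qed

lemma labels_part_subset: "alternative_tableau T \<Longrightarrow> labels (part c T) \<subseteq> labels T"
  using labels_part_Un[of T c] by auto

lemma lab_part_Un:
  assumes T: "alternative_tableau T"
  shows "lab d (part c T) \<union> lab d (part (flip c) T) = lab d T"
proof -
  have "lab d (part e T) = lab d T \<inter> labels (part e T)" for e
    using lab_subset_labels[of d T] by (auto simp: part_def)
  then show ?thesis
    using labels_part_Un[OF T, of c] lab_subset_labels[of d T] by auto
qed

lemma free_part:
  assumes T: "alternative_tableau T"
  shows "free d (part c T) = (if d = c then free c T else {})"
proof -
  have *: "free d (part c T) = free d T \<inter> labels (part c T)" for c
    unfolding labels_part[OF T] unfolding part_def by (rule free_closed[OF T closed_part(1)[OF T]])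
  have "free d T \<subseteq> labels (part d T)" unfolding labels_part[OF T] by auto
  then show ?thesis
    using labels_part_disjoint[OF T, of d] unfolding * by (auto simp: neq_iff_flip)
qed

lemma par_part_Un:
  assumes T: "alternative_tableau T"
  shows "par (part c T) \<union> par (part (flip c) T) = par T"
proof -
  have "par (part d T) = {e \<in> par T. fst e \<in> labels (part d T)}" for d
    unfolding labels_part[OF T] using closed_part(1)[OF T, of d]
    by (auto simp: part_def closed_def)
  then show ?thesis
    using labels_part_Un[OF T, of c] par_labels[OF T] by fastforce
qed

lemma word_part:
  assumes T: "alternative_tableau T"
  shows "word c (part c T) = word c T"
  unfolding part_def by (intro word_closed closed_part T) auto

text \<open>Only the roots have a single colour; below them rows and columns alternate.\<close>

definition monochrome :: "colour \<Rightarrow> tableau \<Rightarrow> bool" where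
  "monochrome c T \<longleftrightarrow> alternative_tableau T \<and> free (flip c) T = {}"

lemma monochrome_part: "alternative_tableau T \<Longrightarrow> monochrome c (part c T)"
  by (simp add: monochrome_def alternative_tableau_part free_part)

text \<open>\<open>U\<close> arises from \<open>T1\<close> and \<open>T2\<close> by adding a new
  extremal root \<open>m\<close> of colour \<open>c\<close>; the product in the last line attaches
  the roots of \<open>T1\<close> to \<open>m\<close> as its children, while the trees of
  \<open>T2\<close> stay separate.\<close>

definition glue :: "colour \<Rightarrow> nat \<Rightarrow> tableau \<Rightarrow> tableau \<Rightarrow> tableau \<Rightarrow> bool" where
  "glue c m T1 T2 U \<longleftrightarrow>
     monochrome c U \<and> monochrome (flip c) T1 \<and> monochrome c T2 \<and>
     labels T1 \<inter> labels T2 = {} \<and> m \<notin> labels T1 \<union> labels T2 \<and>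
     (\<forall>x\<in>labels T1 \<union> labels T2. lt c m x) \<and>
     (\<forall>d. lab d U = lab d T1 \<union> lab d T2 \<union> (if d = c then {m} else {})) \<and>
     par U = par T1 \<union> par T2 \<union> free (flip c) T1 \<times> {m}"

lemma glue_labels:
  assumes "glue c m T1 T2 U"
  shows "labels U = insert m (labels T1 \<union> labels T2)"
proof -
  have "lab c U = insert m (lab c T1 \<union> lab c T2)" "lab (flip c) U = lab (flip c) T1 \<union> lab (flip c) T2"
    using assms unfolding glue_def by simp_all
  then show ?thesis unfolding labels_eq[of _ c] by auto
qed

lemma glue_unique: "glue c m T1 T2 U \<Longrightarrow> glue c m T1 T2 U' \<Longrightarrow> U = U'"
  by (rule alternative_tableau_ext) (simp_all add: glue_def monochrome_def)

text \<open>Deleting the root \<open>m\<close> turns its children into the only roots of colour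
  \<open>flip c\<close>, so \<open>T1\<close> and \<open>T2\<close> are the two parts of
  \<open>del m U\<close>.\<close>

lemma ex_glue_decompose:
  assumes U: "monochrome c U" and m: "m \<in> labels U" "\<forall>x\<in>labels U - {m}. lt c m x"
  shows "\<exists>T1 T2. glue c m T1 T2 U"
proof (intro exI)
  have T: "alternative_tableau U" and c: "free (flip c) U = {}" using U by (auto simp: monochrome_def)
  let ?V = "del m U"
  have V: "alternative_tableau ?V" using T by (rule alternative_tableau_del)
  have mf: "m \<in> free c U" using extreme_is_free[OF T c m] .
  then have m': "m \<in> lab c U" "m \<notin> Domain (par U)" using free_eq[OF T] by auto
  have lun: "labels (part (flip c) ?V) \<union> labels (part c ?V) = labels U - {m}"
    using labels_part_Un[OF V, of "flip c"] by simp
  have lab: "lab d U = lab d (part (flip c) ?V) \<union> lab d (part c ?V) \<union> (if d = c then {m} else {})" for d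
  proof -
    have "m \<in> lab d U \<longleftrightarrow> d = c" using m'(1) lab_unique[OF T m'(1)] by blast
    then show ?thesis using lab_part_Un[OF V, of d "flip c"] by auto
  qed
  have "par U = par ?V \<union> {x. (x, m) \<in> par U} \<times> {m}"
    unfolding par_del[OF T m'(2)] by auto
  also have "{x. (x, m) \<in> par U} = free (flip c) ?V"
    unfolding free_del(2)[OF T mf] c by simp
  also have "\<dots> = free (flip c) (part (flip c) ?V)"
    by (simp add: free_part[OF V])
  also have "par ?V = par (part (flip c) ?V) \<union> par (part c ?V)"
    using par_part_Un[OF V, of "flip c"] by simp
  finally have par: "par U = par (part (flip c) ?V) \<union> par (part c ?V) \<union>
      free (flip c) (part (flip c) ?V) \<times> {m}" .
  show "glue c m (part (flip c) ?V) (part c ?V) U"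
    unfolding glue_def
    using U monochrome_part[OF V] labels_part_disjoint[OF V, of "flip c"] lun m(2) lab par
    by auto
qed

text \<open>Deleting \<open>m\<close> leaves \<open>T1\<close> and \<open>T2\<close> as disjoint
  closed pieces, so in \<open>word_del\<close> each half of the word sees one piece only.\<close>

lemma glue_word:
  assumes g: "glue c m T1 T2 U"
  shows "word c U = word (flip c) T1 @ m # word c T2"
    and "free c U = insert m (free c T2)"
proof -
  have T1: "alternative_tableau T1" "free c T1 = {}" and T2: "alternative_tableau T2" "free (flip c) T2 = {}"
    and U: "alternative_tableau U" "free (flip c) U = {}"
    and disj: "labels T1 \<inter> labels T2 = {}" "m \<notin> labels T1" "m \<notin> labels T2"
    and lab: "\<And>d. lab d U = lab d T1 \<union> lab d T2 \<union> (if d = c then {m} else {})"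
    and par: "par U = par T1 \<union> par T2 \<union> free (flip c) T1 \<times> {m}"
    using g by (auto simp: glue_def monochrome_def)
  have m: "m \<in> labels U" "\<forall>x\<in>labels U - {m}. lt c m x"
    using g glue_labels[OF g] by (auto simp: glue_def)
  have mf: "m \<in> free c U" using extreme_is_free[OF U m] .
  let ?V = "del m U"
  have V: "alternative_tableau ?V" using U(1) by (rule alternative_tableau_del)
  have m': "m \<notin> Domain (par U)" using mf free_eq[OF U(1)] by auto
  note l1 = par_labels[OF T1(1)] and l2 = par_labels[OF T2(1)]
  have parV: "par ?V = par T1 \<union> par T2"
    unfolding par_del[OF U(1) m'] par using l1 l2 disj by auto
  have labV: "lab d ?V = lab d T1 \<union> lab d T2" for d
    using lab[of d] disj lab_subset_labels[of d T1] lab_subset_labels[of d T2] by auto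
  have x12: "par T2 \<inter> labels T1 \<times> labels T1 = {}" "par T1 \<inter> labels T2 \<times> labels T2 = {}"
    "par T1 \<subseteq> labels T1 \<times> labels T1" "par T2 \<subseteq> labels T2 \<times> labels T2"
    using l1 l2 disj by (auto; blast)+
  have r1: "restrict_tableau ?V (labels T1) = T1"
  proof (rule alternative_tableau_ext)
    show "lab d (restrict_tableau ?V (labels T1)) = lab d T1" for d
      using labV[of d] disj lab_subset_labels[of d T1] lab_subset_labels[of d T2] by auto
    show "par (restrict_tableau ?V (labels T1)) = par T1"
      unfolding par_restrict parV using x12 by auto
  qed (auto intro: T1 V alternative_tableau_restrict)
  have r2: "restrict_tableau ?V (labels T2) = T2"
  proof (rule alternative_tableau_ext)
    show "lab d (restrict_tableau ?V (labels T2)) = lab d T2" for d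
      using labV[of d] disj lab_subset_labels[of d T1] lab_subset_labels[of d T2] by auto
    show "par (restrict_tableau ?V (labels T2)) = par T2"
      unfolding par_restrict parV using x12 by auto
  qed (auto intro: T2 V alternative_tableau_restrict)
  have c1: "closed ?V (labels T1)" and c2: "closed ?V (labels T2)"
    unfolding closed_def parV using l1 l2 disj by blast+
  have lV: "labels ?V = labels T1 \<union> labels T2"
    using glue_labels[OF g] disj by auto
  have f1: "free d T1 = free d ?V \<inter> labels T1" and f2: "free d T2 = free d ?V \<inter> labels T2" for d
    using free_closed[OF V c1, of d] free_closed[OF V c2, of d] r1 r2 by auto
  \<comment> \<open>A free label of colour \<open>flip c\<close> lying in \<open>T2\<close> would be
    free in \<open>T2\<close>, which has no such label; the other colour is dual.\<close>
  have s1: "free (flip c) ?V \<subseteq> labels T1" and s2: "free c ?V \<subseteq> labels T2"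
    using f1[of c] f2[of "flip c"] T1(2) T2(2) free_subset_labels[OF V] lV by blast+
  show "word c U = word (flip c) T1 @ m # word c T2"
    unfolding word_del[OF U m] using word_closed[OF V c1 s1] word_closed[OF V c2 s2] r1 r2 by simp
  show "free c U = insert m (free c T2)"
    using free_del(1)[OF U(1) mf] mf f2[of c] s2 by auto
qed

text \<open>The only new grandparent pairs consist of \<open>m\<close> and a child \<open>x\<close>
  of a root of \<open>T1\<close>. Such an \<open>x\<close> has colour \<open>c\<close>, and
  \<open>m\<close> precedes all labels for \<open>lt c\<close>, so the grandparent condition
  survives.\<close>

lemma ex_glue_compose:
  assumes T1: "monochrome (flip c) T1" and T2: "monochrome c T2" and disj: "labels T1 \<inter> labels T2 = {}"
    and m: "\<forall>x\<in>labels T1 \<union> labels T2. lt c m x"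
  shows "\<exists>U. glue c m T1 T2 U"
proof -
  have T1': "alternative_tableau T1" "free c T1 = {}" and T2': "alternative_tableau T2" "free (flip c) T2 = {}"
    using T1 T2 by (auto simp: monochrome_def)
  have mn: "m \<notin> labels T1" "m \<notin> labels T2" using m lt_irrefl by blast+
  define l where "l = (\<lambda>d. lab d T1 \<union> lab d T2 \<union> (if d = c then {m} else {}))"
  define E where "E = par T1 \<union> par T2 \<union> free (flip c) T1 \<times> {m}"
  note p1 = par_labels[OF T1'(1)] and p2 = par_labels[OF T2'(1)]
  note ls = lab_subset_labels[THEN subsetD]
  have fr: "x \<in> lab (flip c) T1 \<and> x \<notin> Domain (par T1) \<and> x \<in> labels T1" if "x \<in> free (flip c) T1" for x
    using that free_eq[OF T1'(1)] ls by auto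
  have l1: "x \<in> lab d T1" if "x \<in> l d" "x \<in> labels T1" for x d
    using that disj mn ls by (auto simp: l_def split: if_splits)
  have l2: "x \<in> lab d T2" if "x \<in> l d" "x \<in> labels T2" for x d
    using that disj mn ls by (auto simp: l_def split: if_splits)
  have "valid l E"
    unfolding valid_def
  proof (intro conjI allI impI)
    show "finite (l d)" for d by (simp add: l_def)
    show "l White \<inter> l Black = {}"
    proof -
      have "lab d T1 \<inter> lab e T2 = {}" "m \<notin> lab d T1" "m \<notin> lab d T2" for d e
        using disj mn ls by blast+
      then show ?thesis
        using lab_disjoint[OF T1'(1), of White] lab_disjoint[OF T2'(1), of White]
        by (cases c) (auto simp: l_def)
    qed
    show "\<exists>d. x \<in> l d \<and> p \<in> l (flip d) \<and> lt d x p" if "(x, p) \<in> E" for x p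
    proof -
      consider "(x, p) \<in> par T1" | "(x, p) \<in> par T2" | "x \<in> free (flip c) T1" "p = m"
        using \<open>(x, p) \<in> E\<close> by (auto simp: E_def)
      then show ?thesis
      proof cases
        case 1
        then obtain d where "x \<in> lab d T1 \<and> p \<in> lab (flip d) T1 \<and> lt d x p"
          using par_lab[OF T1'(1)] by blast
        then show ?thesis by (intro exI[of _ d]) (simp add: l_def)
      next
        case 2
        then obtain d where "x \<in> lab d T2 \<and> p \<in> lab (flip d) T2 \<and> lt d x p"
          using par_lab[OF T2'(1)] by blast
        then show ?thesis by (intro exI[of _ d]) (simp add: l_def)
      next
        case 3
        then show ?thesis using fr m by (intro exI[of _ "flip c"]) (auto simp: l_def)
      qed
    qed
    show "single_valued E"
      using single_valued_par[OF T1'(1)] single_valued_par[OF T2'(1)] fr p1 p2 disj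
      unfolding single_valued_def E_def by blast
    show "lt d q x" if "(x, p) \<in> E \<and> (p, q) \<in> E \<and> x \<in> l d" for x p q d
    proof -
      have xp: "(x, p) \<in> E" and pq: "(p, q) \<in> E" and xl: "x \<in> l d" using that by auto
      have "p \<noteq> m" using pq p1 p2 fr mn by (auto simp: E_def)
      then consider "(x, p) \<in> par T1" "(p, q) \<in> par T1" | "(x, p) \<in> par T2" "(p, q) \<in> par T2"
        | "(x, p) \<in> par T1" "p \<in> free (flip c) T1" "q = m"
        using xp pq p1 p2 fr disj unfolding E_def by blast
      then show ?thesis
      proof cases
        case 1
        then show ?thesis using par_grandparent[OF T1'(1)] l1[OF xl] p1 by blast
      next
        case 2
        then show ?thesis using par_grandparent[OF T2'(1)] l2[OF xl] p2 by blast
      next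
        case 3
        then have "x \<in> lab c T1" using par_parent[OF T1'(1), of x p "flip c"] fr by auto
        moreover have "x \<in> labels T1" using 3 p1 by blast
        ultimately show ?thesis
          using l1[OF xl] lab_unique[OF T1'(1)] m 3 by blast
      qed
    qed
  qed
  then obtain U where U: "alternative_tableau U" "\<And>d. lab d U = l d" "par U = E"
    using ex_alternative_tableau by blast
  have "free (flip c) U = {}"
    unfolding free_eq[OF U(1)] U(2,3)
    using T2'(2) unfolding free_eq[OF T2'(1)] l_def E_def free_eq[OF T1'(1)] by auto
  then have "glue c m T1 T2 U"
    using T1 T2 U disj m mn by (auto simp: glue_def monochrome_def l_def E_def)
  then show ?thesis by blast
qed

text \<open>The property must mention the colour, because the roots of \<open>T1\<close> have the
  opposite one. The number of labels decreases.\<close>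

lemma monochrome_induct [consumes 1, case_names empty glue]:
  assumes "monochrome c U"
    and empty: "\<And>c T. monochrome c T \<Longrightarrow> labels T = {} \<Longrightarrow> P c T"
    and glue: "\<And>c m T1 T2 U. glue c m T1 T2 U \<Longrightarrow> P (flip c) T1 \<Longrightarrow> P c T2 \<Longrightarrow> P c U"
  shows "P c U"
  using assms(1)
proof (induction "card (labels U)" arbitrary: c U rule: less_induct)
  case less
  show ?case
  proof (cases "labels U = {}")
    case True
    then show ?thesis using empty less.prems by blast
  next
    case False
    then obtain m where "m \<in> labels U" "\<forall>x\<in>labels U - {m}. lt c m x"
      using ex_lt_least[OF finite_labels] by blast
    then obtain T1 T2 where g: "glue c m T1 T2 U"
      using ex_glue_decompose[OF less.prems] by blast
    then have "labels T1 \<subset> labels U" "labels T2 \<subset> labels U"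
      using glue_labels[OF g] by (auto simp: glue_def)
    then have "card (labels T1) < card (labels U)" "card (labels T2) < card (labels U)"
      by (simp_all add: psubset_card_mono)
    moreover have "monochrome (flip c) T1" "monochrome c T2" using g by (auto simp: glue_def)
    ultimately show ?thesis using glue[OF g] less.hyps by blast
  qed
qed

section \<open>Words as a bijective coding of monochrome tableaux\<close>

lemma word_empty: "monochrome c T \<Longrightarrow> labels T = {} \<Longrightarrow> word c T = []"
  using free_subset_labels[of T c] by (simp add: word_def monochrome_def)

lemma set_word: "monochrome c T \<Longrightarrow> set (word c T) = labels T"
proof (induction rule: monochrome_induct)
  case (glue c m T1 T2 U)
  then show ?case using glue_labels glue_word(1) by auto
qed (simp add: word_empty)

lemma distinct_word: "monochrome c T \<Longrightarrow> distinct (word c T)"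
proof (induction rule: monochrome_induct)
  case (glue c m T1 T2 U)
  then show ?case
    using set_word[of "flip c" T1] set_word[of c T2] glue_word(1)[OF glue.hyps]
    by (auto simp: glue_def)
qed (simp add: word_empty)

text \<open>The letters are the labels, so both tableaux have the same extremal label
  \<open>m\<close>; as it occurs once in each word, it cuts both words at the same place.\<close>

lemma word_inject: "monochrome c U \<Longrightarrow> monochrome c U' \<Longrightarrow> word c U = word c U' \<Longrightarrow> U = U'"
proof (induction arbitrary: U' rule: monochrome_induct)
  case (empty c T)
  then have "labels U' = {}" using set_word word_empty by metis
  then show ?case using empty by (intro alternative_tableau_labels_empty) (auto simp: monochrome_def)
next
  case (glue c m T1 T2 U)
  have "labels U' = labels U"
    using set_word[OF glue.prems(1)] set_word[of c U] glue.prems(2) glue.hyps by (simp add: glue_def)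
  then have l: "labels U' = insert m (labels T1 \<union> labels T2)"
    using glue_labels[OF glue.hyps] by simp
  then have "m \<in> labels U'" "\<forall>x\<in>labels U' - {m}. lt c m x"
    using glue.hyps by (auto simp: glue_def)
  then obtain T1' T2' where g: "glue c m T1' T2' U'"
    using ex_glue_decompose[OF glue.prems(1)] by blast
  have m: "monochrome (flip c) T1" "monochrome c T2" "monochrome (flip c) T1'" "monochrome c T2'"
    "m \<notin> labels T1" "m \<notin> labels T2" "m \<notin> labels T1'" "m \<notin> labels T2'"
    using glue.hyps g by (auto simp: glue_def)
  then have "word (flip c) T1 = word (flip c) T1'" "word c T2 = word c T2'"
    using glue.prems(2) unfolding glue_word(1)[OF g] glue_word(1)[OF glue.hyps]
    by (auto simp: append_Cons_eq_iff set_word)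
  then have "T1 = T1'" "T2 = T2'" by (auto intro: glue.IH m)
  then show ?case using glue_unique[OF glue.hyps, of U'] g by simp
qed

lemma ex_empty_tableau: "\<exists>T. monochrome c T \<and> labels T = {}"
proof -
  have "valid (\<lambda>_. {}) {}" by (simp add: valid_def single_valued_def)
  then obtain T where T: "alternative_tableau T" "\<And>d. lab d T = {}"
    using ex_alternative_tableau by blast
  then have "monochrome c T \<and> labels T = {}"
    using labels_eq[of T c] free_eq[OF T(1)] by (auto simp: monochrome_def)
  then show ?thesis by blast
qed

text \<open>The word is cut at its extremal letter; the piece before it is realised with the
  opposite colour, the piece after it with the same colour, and the two tableaux are glued.\<close>

lemma word_surj: "distinct w \<Longrightarrow> \<exists>U. monochrome c U \<and> word c U = w"
proof (induction "length w" arbitrary: c w rule: less_induct)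
  case less
  show ?case
  proof (cases "w = []")
    case True
    then show ?thesis using ex_empty_tableau word_empty by blast
  next
    case False
    then obtain m where m: "m \<in> set w" "\<forall>x\<in>set w - {m}. lt c m x"
      using ex_lt_least[of "set w" c] by auto
    obtain w1 w2 where w: "w = w1 @ m # w2" using m(1) split_list by metis
    obtain T1 where T1: "monochrome (flip c) T1" "word (flip c) T1 = w1"
      using less.hyps[of w1] less.prems w by auto
    obtain T2 where T2: "monochrome c T2" "word c T2 = w2"
      using less.hyps[of w2] less.prems w by auto
    obtain U where U: "glue c m T1 T2 U"
      using ex_glue_compose[OF T1(1) T2(1), of m] set_word[OF T1(1)] set_word[OF T2(1)] T1 T2 m(2)
        less.prems w by auto
    then show ?thesis using glue_word(1)[OF U] T1 T2 w by (auto simp: glue_def)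
  qed
qed

section \<open>Statistics\<close>

text \<open>Stated by factors instead of positions, so that it passes at once to longer
  words.\<close>

definition followed :: "nat list \<Rightarrow> nat \<Rightarrow> nat \<Rightarrow> bool" where
  "followed w a b \<longleftrightarrow> (\<exists>u v. w = u @ a # b # v)"

lemma followed_append:
  assumes "followed v a b"
  shows "followed (u @ v @ u') a b"
proof -
  obtain x y where "v = x @ a # b # y" using assms by (auto simp: followed_def)
  then have "u @ v @ u' = (u @ x) @ a # b # (y @ u')" by simp
  then show ?thesis unfolding followed_def by blast
qed

lemmas followed_append1 = followed_append[of _ _ _ "[]", simplified]
  and followed_append2 = followed_append[of _ _ _ _ "[]", simplified]

lemma followed_unique:
  assumes "distinct w" "followed w a b" "followed w a b'"
  shows "b = b'"
proof -
  obtain u v where w: "w = u @ a # b # v"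
    using assms(2) by (auto simp: followed_def)
  moreover obtain u' v' where "w = u' @ a # b' # v'"
    using assms(3) by (auto simp: followed_def)
  ultimately have "u @ a # b # v = u' @ a # b' # v'" by simp
  moreover have "a \<notin> set u" "a \<notin> set (b # v)" using assms(1) unfolding w by auto
  ultimately show ?thesis using append_Cons_eq_iff[of a u "b # v" u' "b' # v'"] by blast
qed

text \<open>Inside a longer word, the word of a forest with black roots is followed by the smaller label
  of the parent of these roots, and dually; \<open>z\<close> plays the role of that letter.\<close>
lemma followed_word:
  assumes "monochrome c U" "\<forall>x\<in>labels U. lt c x z" "a \<in> lab d U"
  shows "\<exists>b. followed (word c U @ [z]) a b \<and> lt d a b"
  using assms
proof (induction arbitrary: z rule: monochrome_induct)
  case (empty c T)
  then show ?case using lab_subset_labels by blast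
next
  case (glue c m T1 T2 U)
  have lU: "labels U = insert m (labels T1 \<union> labels T2)" using glue_labels[OF glue.hyps] .
  have w: "word c U @ [z] = (word (flip c) T1 @ [m]) @ word c T2 @ [z]"
    "word c U @ [z] = word (flip c) T1 @ [m] @ word c T2 @ [z]"
    using glue_word(1)[OF glue.hyps] by simp_all
  have T2: "monochrome c T2" using glue.hyps by (simp add: glue_def)
  have m: "\<forall>x\<in>labels T1 \<union> labels T2. lt c m x" using glue.hyps by (simp add: glue_def)
  have "a \<in> lab d T1 \<union> lab d T2 \<union> (if d = c then {m} else {})"
    using glue.hyps glue.prems(2) unfolding glue_def by blast
  then consider "a \<in> lab d T1" | "a \<in> lab d T2" | "a = m" "d = c"
    by (auto split: if_splits)
  then show ?case
  proof cases
    \<comment> \<open>The word of \<open>T1\<close> is directly followed by \<open>m\<close>, which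
      takes the place of \<open>z\<close> for the opposite colour.\<close>
    case 1
    then show ?thesis
      unfolding w(1) using glue.IH(1)[of m] m followed_append1 by fastforce
  next
    case 2
    then show ?thesis
      unfolding w(1) using glue.IH(2)[of z] glue.prems(1) lU followed_append2 by blast
  next
    case 3
    \<comment> \<open>\<open>b\<close> is the first letter of \<open>word c T2\<close>, or
      \<open>z\<close> if that word is empty.\<close>
    obtain b v where b: "word c T2 @ [z] = b # v" by (cases "word c T2") auto
    then have "b \<in> insert z (labels T2)"
      using set_word[OF T2] by (metis list.set_intros(1) set_append Un_iff insert_iff empty_iff list.set)
    then have "lt c m b" using m glue.prems(1) lU by auto
    moreover have "followed (word c U @ [z]) m b"
      unfolding w(2) b followed_def by auto
    ultimately show ?thesis using 3 by blast
  qed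
qed

text \<open>RL-minima for \<open>White\<close>, RL-maxima for \<open>Black\<close>.\<close>

definition last_extremum :: "colour \<Rightarrow> nat list \<Rightarrow> nat \<Rightarrow> bool" where
  "last_extremum c w a \<longleftrightarrow> (\<exists>u v. w = u @ a # v \<and> (\<forall>x\<in>set v. lt c a x))"

lemma last_extremum_append:
  "last_extremum c (w1 @ w2) a \<longleftrightarrow>
    last_extremum c w2 a \<or> last_extremum c w1 a \<and> (\<forall>x\<in>set w2. lt c a x)"
proof
  assume "last_extremum c (w1 @ w2) a"
  then obtain u v where w: "w1 @ w2 = u @ a # v" and v: "\<forall>x\<in>set v. lt c a x"
    by (auto simp: last_extremum_def)
  from w obtain us where "w1 = u @ us \<and> us @ w2 = a # v \<or> w1 @ us = u \<and> w2 = us @ a # v"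
    unfolding append_eq_append_conv2 by blast
  then show "last_extremum c w2 a \<or> last_extremum c w1 a \<and> (\<forall>x\<in>set w2. lt c a x)"
  proof
    assume "w1 = u @ us \<and> us @ w2 = a # v"
    then show ?thesis
      using v unfolding last_extremum_def by (cases us) fastforce+
  qed (use v in \<open>auto simp: last_extremum_def\<close>)
next
  assume "last_extremum c w2 a \<or> last_extremum c w1 a \<and> (\<forall>x\<in>set w2. lt c a x)"
  then show "last_extremum c (w1 @ w2) a"
  proof
    assume "last_extremum c w2 a"
    then show ?thesis unfolding last_extremum_def by (metis append.assoc)
  next
    assume "last_extremum c w1 a \<and> (\<forall>x\<in>set w2. lt c a x)"
    then obtain u v where "w1 @ w2 = u @ a # (v @ w2)" "\<forall>x\<in>set (v @ w2). lt c a x"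
      by (auto simp: last_extremum_def)
    then show ?thesis unfolding last_extremum_def by blast
  qed
qed

text \<open>Letters from \<open>T1\<close> have the more extreme \<open>m\<close> to their right and
  drop out, \<open>m\<close> itself qualifies, and letters from \<open>T2\<close> are decided by
  induction, as nothing from \<open>T1\<close> or \<open>m\<close> lies to their right.\<close>

lemma free_iff_last_extremum:
  "monochrome c U \<Longrightarrow> a \<in> free c U \<longleftrightarrow> last_extremum c (word c U) a"
proof (induction rule: monochrome_induct)
  case (empty c T)
  then show ?case
    using free_subset_labels[of T c] word_empty by (auto simp: monochrome_def last_extremum_def)
next
  case (glue c m T1 T2 U)
  have mono: "monochrome (flip c) T1" "monochrome c T2" "monochrome c U"
    using glue.hyps by (auto simp: glue_def)
  have w: "word c U = word (flip c) T1 @ [m] @ word c T2"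
    using glue_word(1)[OF glue.hyps] by simp
  have m: "\<forall>x\<in>labels T1 \<union> labels T2. lt c m x" using glue.hyps by (simp add: glue_def)
  have "last_extremum c (word (flip c) T1) a \<Longrightarrow> \<not> lt c a m"
    using set_word[OF mono(1)] m lt_asym by (fastforce simp: last_extremum_def)
  moreover have "last_extremum c [m] a \<longleftrightarrow> a = m"
    by (auto simp: last_extremum_def Cons_eq_append_conv)
  ultimately show ?case
    unfolding w last_extremum_append
    using glue.IH(2) set_word[OF mono(2)] m glue_word(2)[OF glue.hyps] by auto
qed

section \<open>Translation of the statistics to positions in a word\<close>

lemma followed_snoc_nth:
  "(\<exists>b. followed (w @ [z]) a b \<and> lt d a b) \<longleftrightarrow>
    (\<exists>k<length w. w ! k = a \<and> lt d a (if Suc k = length w then z else w ! Suc k))"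
proof -
  have followed: "followed v a b \<longleftrightarrow> (\<exists>k. Suc k < length v \<and> v ! k = a \<and> v ! Suc k = b)" for v b
  proof
    assume "followed v a b"
    then obtain u u' where "v = u @ a # b # u'" by (auto simp: followed_def)
    then show "\<exists>k. Suc k < length v \<and> v ! k = a \<and> v ! Suc k = b"
      by (intro exI[of _ "length u"]) (simp add: nth_append)
  next
    assume "\<exists>k. Suc k < length v \<and> v ! k = a \<and> v ! Suc k = b"
    then obtain k where k: "Suc k < length v" "v ! k = a" "v ! Suc k = b" by blast
    then have "v = take k v @ a # b # drop (Suc (Suc k)) v"
      by (metis Cons_nth_drop_Suc Suc_lessD append_take_drop_id)
    then show "followed v a b" unfolding followed_def by blast
  qed
  have "(w @ [z]) ! k = w ! k" "(w @ [z]) ! Suc k = (if Suc k = length w then z else w ! Suc k)"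
    if "k < length w" for k
    using that by (auto simp: nth_append)
  then have snoc: "followed (w @ [z]) a b \<longleftrightarrow>
      (\<exists>k<length w. w ! k = a \<and> (if Suc k = length w then z else w ! Suc k) = b)" for b
    unfolding followed by (metis Suc_less_eq length_append_singleton)
  show ?thesis unfolding snoc by blast
qed

text \<open>A final letter \<open>z\<close> above all others turns the convention that the last
  letter is an ascent into an ordinary comparison; for the same reason it creates no
  descent.\<close>

lemma is_ascent_iff:
  assumes "\<forall>x\<in>set w. x < z"
  shows "is_ascent w a \<longleftrightarrow> (\<exists>b. followed (w @ [z]) a b \<and> lt White a b)"
proof -
  have "lt White a (if Suc k = length w then z else w ! Suc k) \<longleftrightarrow> Suc k = length w \<or> a < w ! Suc k"
    if "k < length w" "w ! k = a" for k
    using assms nth_mem[OF that(1)] that(2) by (auto simp: lt_def)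
  then show ?thesis
    unfolding is_ascent_def followed_snoc_nth by blast
qed

lemma is_descent_iff:
  assumes "\<forall>x\<in>set w. x < z"
  shows "is_descent w a \<longleftrightarrow> (\<exists>b. followed (w @ [z]) a b \<and> lt Black a b)"
proof -
  have "lt Black a (if Suc k = length w then z else w ! Suc k) \<longleftrightarrow> Suc k < length w \<and> w ! Suc k < a"
    if "k < length w" "w ! k = a" for k
    using assms nth_mem[OF that(1)] that by (auto simp: lt_def)
  then show ?thesis
    unfolding is_descent_def followed_snoc_nth using Suc_lessD by blast
qed

lemma last_extremum_nth:
  "last_extremum c w a \<longleftrightarrow>
    (\<exists>k<length w. w ! k = a \<and> (\<forall>l. k < l \<and> l < length w \<longrightarrow> lt c a (w ! l)))"
proof
  assume "last_extremum c w a"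
  then obtain u v where *: "w = u @ a # v" "\<forall>x\<in>set v. lt c a x"
    by (auto simp: last_extremum_def)
  then show "\<exists>k<length w. w ! k = a \<and> (\<forall>l. k < l \<and> l < length w \<longrightarrow> lt c a (w ! l))"
    by (intro exI[of _ "length u"]) (auto simp: nth_append nth_Cons')
next
  assume "\<exists>k<length w. w ! k = a \<and> (\<forall>l. k < l \<and> l < length w \<longrightarrow> lt c a (w ! l))"
  then obtain k where k: "k < length w" "w ! k = a" "\<forall>l. k < l \<and> l < length w \<longrightarrow> lt c a (w ! l)"
    by blast
  have "w = take k w @ a # drop (Suc k) w" using k by (metis id_take_nth_drop)
  moreover have "\<forall>x\<in>set (drop (Suc k) w). lt c a x"
    using k(3) by (auto simp: in_set_conv_nth)
  ultimately show "last_extremum c w a" unfolding last_extremum_def by blast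
qed

lemma is_RL_minimum_iff: "is_RL_minimum w a \<longleftrightarrow> last_extremum White w a"
  by (simp add: is_RL_minimum_def last_extremum_nth lt_def)

lemma is_RL_maximum_iff: "is_RL_maximum w a \<longleftrightarrow> last_extremum Black w a"
  by (simp add: is_RL_maximum_def last_extremum_nth lt_def)

lemma last_extremum_mem: "last_extremum c w a \<Longrightarrow> a \<in> set w"
  by (auto simp: last_extremum_def)

section \<open>The bijection\<close>

lemma Phi_N_part:
  "alternative_tableau T \<Longrightarrow>
    Phi_N T = word Black (part Black T) @ [0] @ word White (part White T)"
  by (simp add: Phi_N_eq word_part)

text \<open>Labels increase strictly along the border, so their set determines their list.\<close>

lemma standard_iff:
  "T \<in> standard_alternative_tableaux n \<longleftrightarrow> alternative_tableau T \<and> labels T = {1..n}"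
proof -
  have "map fst (border T) = [1..<Suc n] \<longleftrightarrow> labels T = {1..n}" if "alternative_tableau T"
  proof
    assume "map fst (border T) = [1..<Suc n]"
    then have "set (map fst (border T)) = set [1..<Suc n]" by simp
    then show "labels T = {1..n}" by (auto simp: labels_def)
  next
    assume "labels T = {1..n}"
    then have "set (map fst (border T)) = set [1..<Suc n]" by (auto simp: labels_def)
    then show "map fst (border T) = [1..<Suc n]"
      using that strict_sorted_equal[of "[1..<Suc n]" "map fst (border T)"]
      by (simp add: alternative_tableau_def sorted_wrt_upt del: upt_Suc)
  qed
  then show ?thesis by (auto simp: standard_alternative_tableaux_def)
qed

lemma Phi_N_permutation:
  assumes T: "alternative_tableau T" and L: "labels T = {1..n}"
  shows "set (Phi_N T) = {0..n}" "distinct (Phi_N T)"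
proof -
  have w: "set (word c (part c T)) = labels (part c T)" "distinct (word c (part c T))" for c
    using set_word distinct_word monochrome_part[OF T] by auto
  have z: "0 \<notin> labels (part c T)" for c
    using labels_part_subset[OF T, of c] L by auto
  show "set (Phi_N T) = {0..n}"
    using labels_part_Un[OF T, of White] L by (auto simp: Phi_N_part[OF T] w)
  show "distinct (Phi_N T)"
    using labels_part_Un[OF T, of White] labels_part_disjoint[OF T, of White] L
    by (auto simp: Phi_N_part[OF T] w z)
qed

text \<open>The letter \<open>0\<close> occurs once and separates the two halves;
  \<open>word_inject\<close> recovers both parts, and together they determine the tableau.\<close>

lemma inj_on_Phi_N: "inj_on Phi_N (standard_alternative_tableaux n)"
proof (rule inj_onI)
  fix T T' assume st: "T \<in> standard_alternative_tableaux n" "T' \<in> standard_alternative_tableaux n"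
    and eq: "Phi_N T = Phi_N T'"
  have T: "alternative_tableau T" "alternative_tableau T'" and L: "labels T = {1..n}" "labels T' = {1..n}"
    using st by (auto simp: standard_iff)
  have "0 \<notin> set (word c (part c S))" if "alternative_tableau S" "labels S = {1..n}" for c S
    using set_word[OF monochrome_part[OF that(1), of c]] labels_part_subset[OF that(1), of c] that(2)
    by auto
  then have w: "word c (part c T) = word c (part c T')" for c
    using eq T L by (cases c) (simp_all add: Phi_N_part append_Cons_eq_iff)
  have p: "part c T = part c T'" for c
    using word_inject[OF monochrome_part[OF T(1)] monochrome_part[OF T(2)] w] .
  show "T = T'"
  proof (rule alternative_tableau_ext)
    show "lab d T = lab d T'" for d
      using lab_part_Un[OF T(1), of d White] lab_part_Un[OF T(2), of d White] p by simp
    show "par T = par T'"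
      using par_part_Un[OF T(1), of White] par_part_Un[OF T(2), of White] p by simp
  qed (use T in auto)
qed

text \<open>Read as the word of a tableau whose free labels are all rows, \<open>w\<close> has
  \<open>0\<close> as its extremal root; by \<open>word_del\<close> its removal leaves exactly the
  two halves of \<open>Phi_N\<close>.\<close>

lemma Phi_N_surj:
  assumes "w \<in> permutations_of_set {0..n}"
  shows "\<exists>T\<in>standard_alternative_tableaux n. Phi_N T = w"
proof -
  have w: "distinct w" "set w = {0..n}" using assms by (auto simp: permutations_of_set_def)
  obtain U where U: "monochrome White U" "word White U = w" using word_surj[OF w(1)] by blast
  then have lU: "labels U = {0..n}" using set_word w(2) by metis
  then have "\<forall>x\<in>labels U - {0}. lt White 0 x" "0 \<in> labels U" by (auto simp: lt_def)
  then have "word White U = word Black (del 0 U) @ [0] @ word White (del 0 U)"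
    using word_del[of U White 0] U(1) by (simp add: monochrome_def)
  moreover have d: "alternative_tableau (del 0 U)"
    using U(1) alternative_tableau_del by (simp add: monochrome_def)
  ultimately have "Phi_N (del 0 U) = w" using U(2) Phi_N_eq by simp
  moreover have "del 0 U \<in> standard_alternative_tableaux n"
    unfolding standard_iff labels_del lU using d by auto
  ultimately show ?thesis by blast
qed

text \<open>\<open>followed_word\<close> is applied to both halves, with \<open>z = 0\<close> for
  the black and \<open>z = Suc n\<close> for the white one. Conversely, a letter of a distinct word
  has only one successor, so comparing the two reveals its colour.\<close>

lemma Phi_N_ascent_descent:
  assumes T: "alternative_tableau T" and L: "labels T = {1..n}" and i: "i \<in> {1..n}"
  shows "i \<in> lab d T \<longleftrightarrow> (\<exists>b. followed (Phi_N T @ [Suc n]) i b \<and> lt d i b)"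
proof -
  have sub: "labels (part c T) \<subseteq> {1..n}" for c using labels_part_subset[OF T, of c] L by simp
  have P: "Phi_N T @ [Suc n] = (word Black (part Black T) @ [0]) @ word White (part White T) @ [Suc n]"
    by (simp add: Phi_N_part[OF T])
  have *: "\<exists>b. followed (Phi_N T @ [Suc n]) i b \<and> lt d i b" if "i \<in> lab d T" for d
  proof -
    consider "i \<in> lab d (part White T)" | "i \<in> lab d (part Black T)"
      using \<open>i \<in> lab d T\<close> lab_part_Un[OF T, of d White] by auto
    then show ?thesis
    proof cases
      case 1
      have "\<forall>x\<in>labels (part White T). lt White x (Suc n)" using sub by (fastforce simp: lt_def)
      from followed_word[OF monochrome_part[OF T] this 1] show ?thesis
        unfolding P using followed_append2 by blast
    next
      case 2
      have "\<forall>x\<in>labels (part Black T). lt Black x 0" using sub by (fastforce simp: lt_def)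
      from followed_word[OF monochrome_part[OF T] this 2] show ?thesis
        unfolding P using followed_append1 by blast
    qed
  qed
  have dist: "distinct (Phi_N T @ [Suc n])" using Phi_N_permutation[OF T L] by auto
  show ?thesis
  proof
    assume "\<exists>b. followed (Phi_N T @ [Suc n]) i b \<and> lt d i b"
    then obtain b where b: "followed (Phi_N T @ [Suc n]) i b" "lt d i b" by blast
    show "i \<in> lab d T"
    proof (rule ccontr)
      assume "i \<notin> lab d T"
      then have "i \<in> lab (flip d) T" using i L labels_eq[of T d] by auto
      then obtain b' where b': "followed (Phi_N T @ [Suc n]) i b'" "lt (flip d) i b'" using * by blast
      then have "b = b'" using followed_unique[OF dist b(1)] by blast
      then show False using b(2) b'(2) lt_asym by auto
    qed
  qed (rule *)
qed

lemma Phi_N_free: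
  assumes T: "alternative_tableau T" and L: "labels T = {1..n}" and i: "i \<in> {1..n}"
  shows "i \<in> free_rows T \<longleftrightarrow> is_RL_minimum (Phi_N T) i"
    and "i \<in> free_cols T \<longleftrightarrow> is_shifted_RL_maximum (Phi_N T) i"
proof -
  have free: "i \<in> free c T \<longleftrightarrow> last_extremum c (word c (part c T)) i" for c
    using free_iff_last_extremum[OF monochrome_part[OF T]] free_part[OF T] by simp
  let ?u = "word Black (part Black T)" and ?v = "word White (part White T)"
  have P: "Phi_N T = ?u @ [0] @ ?v" by (rule Phi_N_part[OF T])
  have d: "0 \<notin> set ?u" "0 \<notin> set ?v"
    using Phi_N_permutation(2)[OF T L] unfolding P by auto
  \<comment> \<open>No positive letter up to and including \<open>0\<close> is an RL-minimum: those
    before \<open>0\<close> have it to their right, and \<open>i\<close> is not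
    \<open>0\<close>.\<close>
  have "\<not> last_extremum White [0] i"
    using i last_extremum_mem by fastforce
  then have "last_extremum White (Phi_N T) i \<longleftrightarrow> last_extremum White ?v i"
    unfolding P last_extremum_append by (auto simp: lt_def)
  then show "i \<in> free_rows T \<longleftrightarrow> is_RL_minimum (Phi_N T) i"
    using free[of White] by (simp add: free_def is_RL_minimum_iff)
  \<comment> \<open>As \<open>0\<close> occurs once, the factorisation in
    \<open>is_shifted_RL_maximum\<close> is unique.\<close>
  have "w1 = ?u" if "Phi_N T = w1 @ [0] @ w2" for w1 w2
  proof -
    have "?u @ 0 # ?v = w1 @ 0 # w2" using that unfolding P by simp
    then show ?thesis using append_Cons_eq_iff[of 0 ?u ?v w1 w2] d by blast
  qed
  then have "is_shifted_RL_maximum (Phi_N T) i \<longleftrightarrow> last_extremum Black ?u i"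
    unfolding is_shifted_RL_maximum_def is_RL_maximum_iff using P by blast
  then show "i \<in> free_cols T \<longleftrightarrow> is_shifted_RL_maximum (Phi_N T) i"
    using free[of Black] by (simp add: free_def)
qed

theorem theorem5p4:
  fixes n :: nat
  shows "bij_betw Phi_N (standard_alternative_tableaux n) (permutations_of_set {0..n}) \<and>
    (\<forall>T \<in> standard_alternative_tableaux n. \<forall>i \<in> {1..n}.
       (i \<in> row_labels T \<longleftrightarrow> is_ascent (Phi_N T) i) \<and>
       (i \<in> col_labels T \<longleftrightarrow> is_descent (Phi_N T) i) \<and>
       (i \<in> free_rows T \<longleftrightarrow> is_RL_minimum (Phi_N T) i) \<and>
       (i \<in> free_cols T \<longleftrightarrow> is_shifted_RL_maximum (Phi_N T) i))"
proof (intro conjI ballI)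
  have "Phi_N T \<in> permutations_of_set {0..n}" if "T \<in> standard_alternative_tableaux n" for T
    using that Phi_N_permutation[of T n] by (simp add: standard_iff permutations_of_set_def)
  then show "bij_betw Phi_N (standard_alternative_tableaux n) (permutations_of_set {0..n})"
    unfolding bij_betw_def using inj_on_Phi_N Phi_N_surj by blast
next
  fix T i assume "T \<in> standard_alternative_tableaux n" and i: "i \<in> {1..n}"
  then have T: "alternative_tableau T" and L: "labels T = {1..n}" by (auto simp: standard_iff)
  have less: "\<forall>x\<in>set (Phi_N T). x < Suc n" using Phi_N_permutation(1)[OF T L] by auto
  show "i \<in> row_labels T \<longleftrightarrow> is_ascent (Phi_N T) i"
    using Phi_N_ascent_descent[OF T L i, of White] is_ascent_iff[OF less] by (simp add: lab_def)
  show "i \<in> col_labels T \<longleftrightarrow> is_descent (Phi_N T) i"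
    using Phi_N_ascent_descent[OF T L i, of Black] is_descent_iff[OF less] by (simp add: lab_def)
qed (simp_all add: standard_iff Phi_N_free)

end
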